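(* Let $n\ge 1$ and $0\le m\le n$ be integers. Let $a_j$, $b_{jk}$, $f_j$ ($1\le j,k\le n$) be real-valued $C^\infty$ functions on $[0,1]\times[0,\infty)$, let $h_j$ ($1\le j\le n$) be real-valued $C^\infty$ functions on $[0,\infty)$, and let $\varphi_j$ ($1\le j\le n$) be real-valued continuous functions on $[0,1]$. Assume that: (1) $a_j>0$ on $[0,1]\times[0,\infty)$ for all $j\le m$, and $a_j<0$ on $[0,1]\times[0,\infty)$ for all $j>m$; (2) $\inf_{x,t}|a_j(x,t)|>0$ for all $j\le n$, the infimum being over $(x,t)\in[0,1]\times[0,\infty)$; (3) for all $1\le j\ne k\le n$ there exists $p_{jk}\in C^1([0,1]\times\mathbb{R})$ such that, on $[0,1]\times[0,\infty)$, $b_{jk}=p_{jk}(a_k-a_j)$, and $p_{jk}=0$ in the interior of the set $\{(x,t): a_j(x,t)=a_k(x,t)\}$. Consider the initial-boundary value problem for $u=(u_1,\dots,u_n)$ $$\partial_t u_j+a_j(x,t)\,\partial_x u_j+\sum_{k=1}^n b_{jk}(x,t)\,u_k=f_j(x,t),\quad 1\le j\le n,\ 0<x<1,\ t>0,$$ $$u_j(x,0)=\varphi_j(x),\quad 1\le j\le n,\ x\in[0,1],$$ $$u_j(0,t)=h_j(t)\ \text{ for } 1\le j\le m,\qquad u_j(1,t)=h_j(t)\ \text{ for } m<j\le n.$$ Then any continuous solution $u$ (in the integrated sense defined in the context) to this problem is smoothing, i.e., for every $k\in\mathbb{N}$ there exists $T>0$ such that $u_j\in C^k([0,1]\times[T,\infty))$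 for all $j\le n$.
   Context: Characteristics. For $j\le n$ and $(x,t)\in[0,1]\times[0,\infty)$, the $j$-th characteristic through $(x,t)$ is the graph of the solution $\xi\mapsto\omega_j(\xi;x,t)$ of $$\partial_\xi\omega_j(\xi;x,t)=\frac{1}{a_j(\xi,\omega_j(\xi;x,t))},\qquad \omega_j(x;x,t)=t.$$ It reaches the boundary of $\{(x,t):0<x<1,\ t>0\}$ in two points with distinct ordinates ($t$-coordinates); $x_j(x,t)$ denotes the abscissa ($x$-coordinate) of the one with the smaller ordinate. (Thus, going backward in time along the characteristic, one exits either through the lateral side $x=0$ if $j\le m$, resp. $x=1$ if $j>m$, or through the initial line $t=0$.) Put $$c_j(\xi,x,t)=\exp\int_x^\xi\Big(\frac{b_{jj}}{a_j}\Big)(\eta,\omega_j(\eta;x,t))\,d\eta,\qquad d_j(\xi,x,t)=\frac{c_j(\xi,x,t)}{a_j(\xi,\omega_j(\xi;x,t))}.$$ Continuous solution. A continuous function $u:[0,1]\times[0,\infty)\to\mathbb{R}^n$ is called a continuous solution of the problem if for all $j\le n$ and all $(x,t)\in[0,1]\times[0,\infty)$, with $x_j=x_j(x,t)$ and $t_j=\omega_j(x_j;x,t)$, $$u_j(x,t)=c_j(x_j,x,t)\,s_j(x_j,t_j)-\int_{x_j}^x d_j(\xi,x,t)\sum_{k\ne j}b_{jk}(\xi,\omega_j(\xi;x,t))\,u_k(\xi,\omega_j(\xi;x,t))\,d\xi+\int_{x_j}^x d_j(\xi,x,t)\,f_j(\xi,\omega_j(\xi;x,t))\,d\xi,$$ where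 $s_j(x_j,t_j)=h_j(t_j)$ if $t_j>0$ and $s_j(x_j,t_j)=\varphi_j(x_j)$ if $t_j=0$. *)

theory Defs
  imports "HOL-Analysis.Analysis"
begin

(* C^k on a possibly non-open set S. Derivatives are taken within S, so they are one-sided at
   boundary points; on the sets used here (convex with nonempty interior) the gradient g is uniquely
   determined by f. *)
fun Ck_on :: "nat \<Rightarrow> ('a::euclidean_space \<Rightarrow> real) \<Rightarrow> 'a set \<Rightarrow> bool" where
  "Ck_on 0 f S \<longleftrightarrow> continuous_on S f"
| "Ck_on (Suc k) f S \<longleftrightarrow>
     (\<exists>g. (\<forall>z\<in>S. (f has_derivative (\<lambda>v. g z \<bullet> v)) (at z within S)) \<and>
          (\<forall>e\<in>Basis. Ck_on k (\<lambda>z. g z \<bullet> e) S))"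

definition Cinf_on :: "('a::euclidean_space \<Rightarrow> real) \<Rightarrow> 'a set \<Rightarrow> bool" where
  "Cinf_on f S \<longleftrightarrow> (\<forall>k. Ck_on k f S)"

definition strip :: "(real \<times> real) set" where
  "strip = {0..1} \<times> {0..}"

(* In what follows, a is a single coefficient a_j, and points are pairs (x, t). *)

(* w is a solution of the characteristic equation with w(x) = t on the closed interval with
   endpoints x and \<xi>, its graph remaining in the strip. *)
definition char_arc :: "(real \<times> real \<Rightarrow> real) \<Rightarrow> real \<Rightarrow> real \<Rightarrow> real \<Rightarrow> (real \<Rightarrow> real) \<Rightarrow> bool" where
  "char_arc a x t \<xi> w \<longleftrightarrow>
     w x = t \<and>
     (\<forall>\<eta>\<in>closed_segment x \<xi>. (\<eta>, w \<eta>) \<in> strip \<and>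
        (w has_real_derivative 1 / a (\<eta>, w \<eta>)) (at \<eta> within closed_segment x \<xi>))"

(* the maximal set of abscissas over which the characteristic through (x, t) stays in the strip *)
definition char_dom :: "(real \<times> real \<Rightarrow> real) \<Rightarrow> real \<Rightarrow> real \<Rightarrow> real set" where
  "char_dom a x t = {\<xi>. \<exists>w. char_arc a x t \<xi> w}"

(* omega a \<xi> x t is the value at \<xi> of the characteristic through (x, t); it is meaningful only for
   \<xi> in char_dom a x t. *)
definition omega :: "(real \<times> real \<Rightarrow> real) \<Rightarrow> real \<Rightarrow> real \<Rightarrow> real \<Rightarrow> real" where
  "omega a \<xi> x t = (THE \<tau>. \<exists>w. char_arc a x t \<xi> w \<and> w \<xi> = \<tau>)"

definition char_boundary :: "(real \<times> real \<Rightarrow> real) \<Rightarrow> real \<Rightarrow> real \<Rightarrow> real set" where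
  "char_boundary a x t =
     {\<xi> \<in> char_dom a x t. (\<xi>, omega a \<xi> x t) \<in> frontier ({0<..<1} \<times> {0<..})}"

(* The abscissa of the boundary point of the characteristic with the smallest ordinate. There are
   two boundary points, except when (x, t) is the corner (1, 0) with a > 0 or (0, 0) with a < 0:
   then the characteristic is a single point and the abscissa is x itself. *)
definition char_exit :: "(real \<times> real \<Rightarrow> real) \<Rightarrow> real \<Rightarrow> real \<Rightarrow> real" where
  "char_exit a x t = (THE \<xi>. \<xi> \<in> char_boundary a x t \<and>
     (\<forall>\<eta>\<in>char_boundary a x t. omega a \<xi> x t \<le> omega a \<eta> x t))"

(* LBINT \<eta>=p..q changes sign when p and q are interchanged, as needed here. *)
definition c_coef ::
  "(real \<times> real \<Rightarrow> real) \<Rightarrow> (real \<times> real \<Rightarrow> real) \<Rightarrow> real \<Rightarrow> real \<Rightarrow> real \<Rightarrow> real" where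
  "c_coef a bjj \<xi> x t =
     exp (LBINT \<eta>=ereal x..ereal \<xi>. bjj (\<eta>, omega a \<eta> x t) / a (\<eta>, omega a \<eta> x t))"

definition d_coef ::
  "(real \<times> real \<Rightarrow> real) \<Rightarrow> (real \<times> real \<Rightarrow> real) \<Rightarrow> real \<Rightarrow> real \<Rightarrow> real \<Rightarrow> real" where
  "d_coef a bjj \<xi> x t = c_coef a bjj \<xi> x t / a (\<xi>, omega a \<xi> x t)"

(* The lateral side through which the j-th characteristic enters (x = 0 for j \<le> m, x = 1 for j > m)
   is determined by the sign of a j, so m does not occur. *)
definition continuous_solution ::
  "nat \<Rightarrow> (nat \<Rightarrow> real \<times> real \<Rightarrow> real) \<Rightarrow> (nat \<Rightarrow> nat \<Rightarrow> real \<times> real \<Rightarrow> real) \<Rightarrow>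
   (nat \<Rightarrow> real \<times> real \<Rightarrow> real) \<Rightarrow> (nat \<Rightarrow> real \<Rightarrow> real) \<Rightarrow> (nat \<Rightarrow> real \<Rightarrow> real) \<Rightarrow>
   (nat \<Rightarrow> real \<times> real \<Rightarrow> real) \<Rightarrow> bool" where
  "continuous_solution n a b f h \<phi> u \<longleftrightarrow>
     (\<forall>j\<in>{1..n}. continuous_on strip (u j)) \<and>
     (\<forall>j\<in>{1..n}. \<forall>(x, t)\<in>strip.
        let xj = char_exit (a j) x t;
            tj = omega (a j) xj x t;
            s = (if tj > 0 then h j tj else \<phi> j xj)
        in u j (x, t) =
             c_coef (a j) (b j j) xj x t * s
             - (LBINT \<xi>=ereal xj..ereal x. d_coef (a j) (b j j) \<xi> x t *
                  (\<Sum>k\<in>{1..n} - {j}. b j k (\<xi>, omega (a j) \<xi> x t) * u k (\<xi>, omega (a j) \<xi> x t)))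
             + (LBINT \<xi>=ereal xj..ereal x. d_coef (a j) (b j j) \<xi> x t * f j (\<xi>, omega (a j) \<xi> x t)))"

definition smoothing :: "nat \<Rightarrow> (nat \<Rightarrow> real \<times> real \<Rightarrow> real) \<Rightarrow> bool" where
  "smoothing n u \<longleftrightarrow> (\<forall>k. \<exists>T>0. \<forall>j\<in>{1..n}. Ck_on k (u j) ({0..1} \<times> {T..}))"

end

theory Submission
  imports Defs
begin

text \<open>
  All speeds are bounded away from zero, so the system can be read as an evolution in \<open>x\<close>: with
  \<open>\<alpha>\<^sub>j = 1 / a\<^sub>j\<close> and \<open>X\<^sub>j = \<partial>\<^sub>x + \<alpha>\<^sub>j \<partial>\<^sub>t\<close> it becomes
  \<open>X\<^sub>j u\<^sub>j + \<Sum>\<^sub>l B\<^sub>j\<^sub>l u\<^sub>l = F\<^sub>j\<close>, where \<open>B\<^sub>j\<^sub>l = b\<^sub>j\<^sub>l / a\<^sub>j\<close> and \<open>F\<^sub>j = f\<^sub>j / a\<^sub>j\<close>.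
  The bound on \<open>\<alpha>\<^sub>j\<close> limits the time that a characteristic spends between \<open>x = 0\<close> and \<open>x = 1\<close>. After that
  time the initial data are forgotten: every characteristic comes in from a lateral side, where the
  smooth function \<open>h\<^sub>j\<close> is prescribed. What could still carry a singularity is the coupling through
  \<open>B\<^sub>j\<^sub>k u\<^sub>k\<close> with \<open>k \<noteq> j\<close>.

  The factorization \<open>b\<^sub>j\<^sub>k = p\<^sub>j\<^sub>k (a\<^sub>k - a\<^sub>j)\<close> says that \<open>B\<^sub>j\<^sub>k = P\<^sub>j\<^sub>k (\<alpha>\<^sub>j - \<alpha>\<^sub>k)\<close> with
  \<open>P\<^sub>j\<^sub>k = p\<^sub>j\<^sub>k a\<^sub>k\<close> of class \<open>C\<^sup>1\<close>, and \<open>(\<alpha>\<^sub>j - \<alpha>\<^sub>k) \<partial>\<^sub>t = X\<^sub>j - X\<^sub>k\<close>. Let \<open>W\<close> be a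
  \<open>t\<close>-antiderivative of \<open>w = P\<^sub>j\<^sub>k u\<^sub>k\<close> that starts on a \<open>k\<close>-th characteristic. Then
  \<open>B\<^sub>j\<^sub>k u\<^sub>k = (\<alpha>\<^sub>j - \<alpha>\<^sub>k) \<partial>\<^sub>t W = X\<^sub>j W - X\<^sub>k W\<close>, and \<open>R = X\<^sub>k W\<close> is one degree smoother in \<open>t\<close> than it
  seems: \<open>\<partial>\<^sub>t R = X\<^sub>k w + (\<partial>\<^sub>t \<alpha>\<^sub>k) w\<close> is continuous, because \<open>u\<^sub>k\<close> is differentiable along the
  \<open>k\<close>-th characteristics (lemmas \<open>along_t_antiderivative\<close> and \<open>coupling_absorbed\<close>). Consequently
  \<open>y\<^sub>j = u\<^sub>j + \<Sum>\<^sub>k W\<^sub>k\<close> satisfies a scalar equation \<open>X\<^sub>j y\<^sub>j + B\<^sub>j\<^sub>j y\<^sub>j = H\<close> whose right-hand side and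
  boundary values have continuous \<open>t\<close>-derivatives. Solving it along characteristics shows that \<open>y\<^sub>j\<close>,
  hence \<open>u\<^sub>j\<close>, has a continuous \<open>t\<close>-derivative (\<open>t_smooth_transport\<close>, \<open>solution_gains_t_derivative\<close>).

  Higher regularity follows by induction on \<open>k\<close>, simultaneously for all systems with the same speeds
  and the same off-diagonal coupling: \<open>\<partial>\<^sub>t u\<close> solves a system of this kind in which only the diagonal
  coefficients, the right-hand side and the boundary values have changed (\<open>t_derivative_solution\<close>),
  and \<open>\<partial>\<^sub>x u\<close> is recovered from the equation. Only one derivative of \<open>p\<^sub>j\<^sub>k\<close> is ever taken, since each
  step starts again from the unchanged factorization (\<open>solution_smoothing\<close>).

  The characteristics are constructed by Picard iteration. They are labelled by their height
  at \<open>x = 0\<close>, so that derivatives along characteristics become partial derivatives in \<open>x\<close> at a fixed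
  label.
\<close>

section \<open>Integrals with a variable upper limit\<close>

text \<open>
  Moves the variable limit into the integrand, where continuity in a parameter is easy to exploit.
\<close>
lemma integral_rescale_unit:
  fixes g :: "real \<Rightarrow> real"
  assumes "c \<le> x" "continuous_on {c..x} g"
  shows "integral {c..x} g = (x - c) * integral {0..1} (\<lambda>\<theta>. g (c + \<theta> * (x - c)))"
proof (cases "c = x")
  case False
  then have cx: "c < x" using assms by simp
  have "(g has_integral integral {c..x} g) (cbox c x)"
    using integrable_integral[OF integrable_continuous_interval[OF assms(2)]] by simp
  from has_integral_affinity[OF this, of "x - c" c]
  have "((\<lambda>\<theta>. g ((x - c) * \<theta> + c)) has_integral (1 / (x - c)) * integral {c..x} g)
      ((\<lambda>y. (1 / (x - c)) *\<^sub>R y + - (1 / (x - c) * c)) ` {c..x})"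
    using cx by simp
  moreover have "(\<lambda>y. (1 / (x - c)) *\<^sub>R y + - (1 / (x - c) * c)) ` {c..x} = {0..1}"
  proof -
    have "(\<lambda>y. (1 / (x - c)) * y + - (1 / (x - c) * c)) ` {c..x}
       = {(1 / (x - c)) * c + - (1 / (x - c) * c) .. (1 / (x - c)) * x + - (1 / (x - c) * c)}"
      using cx by (subst image_affinity_atLeastAtMost) auto
    also have "\<dots> = {0..1}"
    proof -
      have "x / (x - c) - c / (x - c) = 1"
        using cx by (simp add: diff_divide_distrib[symmetric])
      then show ?thesis by simp
    qed
    finally show ?thesis by simp
  qed
  ultimately have "((\<lambda>\<theta>. g ((x - c) * \<theta> + c)) has_integral (1 / (x - c)) * integral {c..x} g) {0..1}"
    by simp
  then have "integral {0..1} (\<lambda>\<theta>. g (c + \<theta> * (x - c))) = (1 / (x - c)) * integral {c..x} g"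
    by (simp only: integral_unique mult.commute[of _ "x - c"] add.commute[of c])
  then show ?thesis using cx by simp
qed simp

lemma continuous_on_integral_upper_limit:
  fixes g :: "'a::metric_space \<Rightarrow> real \<Rightarrow> real"
  assumes g: "continuous_on (X \<times> J) (\<lambda>(p, y). g p y)"
    and J: "convex J" "c \<in> J" "\<And>y. y \<in> J \<Longrightarrow> c \<le> y"
  shows "continuous_on (X \<times> J) (\<lambda>(p, y). integral {c..y} (g p))"
proof -
  have sub: "{c..y} \<subseteq> J" if "y \<in> J" for y
    using that J by (metis closed_segment_eq_real_ivl closed_segment_subset)
  have mem: "c + \<theta> * (y - c) \<in> J" if "y \<in> J" "\<theta> \<in> {0..1}" for y \<theta>
  proof -
    have "c + \<theta> * (y - c) \<in> {c..y}"
      using that J(3)[OF that(1)] mult_left_le_one_le[of "y - c" \<theta>] by auto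
    with sub[OF that(1)] show ?thesis by blast
  qed
  have "continuous_on ((X \<times> J) \<times> cbox (0::real) 1) (\<lambda>(q, \<theta>). g (fst q) (c + \<theta> * (snd q - c)))"
  proof -
    have "continuous_on ((X \<times> J) \<times> cbox (0::real) 1)
       (\<lambda>z. (\<lambda>(p, y). g p y) (fst (fst z), c + snd z * (snd (fst z) - c)))"
      by (rule continuous_on_compose2[OF g]) (auto intro!: continuous_intros mem)
    then show ?thesis by (simp add: split_beta)
  qed
  from integral_continuous_on_param[OF this]
  have "continuous_on (X \<times> J)
     (\<lambda>q. (snd q - c) * integral {0..1} (\<lambda>\<theta>. g (fst q) (c + \<theta> * (snd q - c))))"
    by (intro continuous_intros) simp
  moreover have "(snd q - c) * integral {0..1} (\<lambda>\<theta>. g (fst q) (c + \<theta> * (snd q - c)))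
     = (\<lambda>(p, y). integral {c..y} (g p)) q" if "q \<in> X \<times> J" for q
  proof -
    have "continuous_on {c..snd q} (\<lambda>y. (\<lambda>(p, y). g p y) (fst q, y))"
      using that sub[of "snd q"]
      by (intro continuous_on_compose2[OF g]) (auto simp: subset_iff intro!: continuous_intros)
    then show ?thesis using that J(3)[of "snd q"]
      by (simp add: integral_rescale_unit split_beta mem_Times_iff)
  qed
  ultimately show ?thesis
    by (subst (asm) continuous_on_cong) auto
qed

lemma at_within_atLeast_local: "(x::real) < d \<Longrightarrow> at x within {c..} = at x within {c..d}"
  by (rule at_within_nhd[of x "{..<d}"]) auto

lemma has_real_derivative_integral_atLeast:
  fixes g :: "real \<Rightarrow> real"
  assumes "continuous_on {c..} g" "c \<le> y"
  shows "((\<lambda>y. integral {c..y} g) has_real_derivative g y) (at y within {c..})"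
  unfolding at_within_atLeast_local[of y "y + 1" c, simplified]
  using assms by (intro integral_has_real_derivative) (auto elim: continuous_on_subset)

section \<open>The flow of a scalar field on the unit interval\<close>

text \<open>
  The equation \<open>\<gamma>' x = \<alpha> (x, \<gamma> x)\<close> for \<open>x\<close> in the unit interval, where \<open>\<alpha>\<close> is the reciprocal of a
  propagation speed. The field is defined for all real \<open>t\<close> and bounded by \<open>M\<close>, so solutions cannot
  escape; it is only locally Lipschitz in \<open>t\<close>, through its derivative \<open>\<alpha>'\<close>.
\<close>
locale char_flow =
  fixes \<alpha> \<alpha>' :: "real \<times> real \<Rightarrow> real" and M :: real
  assumes cont: "continuous_on ({0..1} \<times> UNIV) \<alpha>"
    and cont': "continuous_on ({0..1} \<times> UNIV) \<alpha>'"
    and deriv: "x \<in> {0..1} \<Longrightarrow> ((\<lambda>t. \<alpha> (x, t)) has_real_derivative \<alpha>' (x, t)) (at t)"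
    and bound: "x \<in> {0..1} \<Longrightarrow> \<bar>\<alpha> (x, t)\<bar> \<le> M"
begin

definition solves :: "real set \<Rightarrow> (real \<Rightarrow> real) \<Rightarrow> bool" where
  "solves I \<gamma> \<longleftrightarrow> (\<forall>x\<in>I. (\<gamma> has_real_derivative \<alpha> (x, \<gamma> x)) (at x within I))"

text \<open>
  The difference quotient of the field in \<open>t\<close>, extended continuously to the diagonal by the Hadamard
  integral.
\<close>
definition mean_slope :: "real \<Rightarrow> real \<Rightarrow> real \<Rightarrow> real" where
  "mean_slope x t\<^sub>1 t\<^sub>2 = integral {0..1} (\<lambda>\<theta>. \<alpha>' (x, t\<^sub>1 + \<theta> * (t\<^sub>2 - t\<^sub>1)))"

lemma mean_slope:
  assumes "x \<in> {0..1}"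
  shows "\<alpha> (x, t\<^sub>2) - \<alpha> (x, t\<^sub>1) = mean_slope x t\<^sub>1 t\<^sub>2 * (t\<^sub>2 - t\<^sub>1)"
proof -
  have "((\<lambda>\<theta>. \<alpha> (x, t\<^sub>1 + \<theta> * (t\<^sub>2 - t\<^sub>1))) has_real_derivative
      \<alpha>' (x, t\<^sub>1 + \<theta> * (t\<^sub>2 - t\<^sub>1)) * (t\<^sub>2 - t\<^sub>1)) (at \<theta> within {0..1})" for \<theta>
    by (rule DERIV_subset[OF DERIV_chain2[OF deriv[OF assms]]]) (auto intro!: derivative_eq_intros)
  then have "((\<lambda>\<theta>. \<alpha>' (x, t\<^sub>1 + \<theta> * (t\<^sub>2 - t\<^sub>1)) * (t\<^sub>2 - t\<^sub>1)) has_integral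
      \<alpha> (x, t\<^sub>1 + 1 * (t\<^sub>2 - t\<^sub>1)) - \<alpha> (x, t\<^sub>1 + 0 * (t\<^sub>2 - t\<^sub>1))) {0..1}"
    by (intro fundamental_theorem_of_calculus)
       (auto simp: has_real_derivative_iff_has_vector_derivative)
  from integral_unique[OF this] show ?thesis by (simp add: mean_slope_def)
qed

lemma continuous_mean_slope:
  "continuous_on ({0..1} \<times> UNIV \<times> UNIV) (\<lambda>(x, t\<^sub>1, t\<^sub>2). mean_slope x t\<^sub>1 t\<^sub>2)"
proof -
  have "continuous_on (({0..1} \<times> UNIV \<times> UNIV) \<times> cbox 0 1)
     (\<lambda>(q, \<theta>::real). \<alpha>' (fst q, fst (snd q) + \<theta> * (snd (snd q) - fst (snd q))))"
    unfolding split_beta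
    by (rule continuous_on_compose2[OF cont']) (auto intro!: continuous_intros)
  from integral_continuous_on_param[OF this] show ?thesis
    by (simp add: mean_slope_def split_beta)
qed

lemma mean_slope_self [simp]: "mean_slope x t t = \<alpha>' (x, t)"
  by (simp add: mean_slope_def)

lemma solves_continuous: "solves I \<gamma> \<Longrightarrow> continuous_on I \<gamma>"
  unfolding solves_def by (meson DERIV_continuous continuous_on_eq_continuous_within)

lemma solves_subset: "solves I \<gamma> \<Longrightarrow> J \<subseteq> I \<Longrightarrow> solves J \<gamma>"
  unfolding solves_def by (meson DERIV_subset subsetD)

lemma continuous_along:
  assumes "continuous_on ({0..1} \<times> UNIV) g" "continuous_on I \<gamma>" "I \<subseteq> {0..1}"
  shows "continuous_on I (\<lambda>x. g (x, \<gamma> x))"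
  by (rule continuous_on_compose2[OF assms(1)]) (use assms in \<open>auto intro!: continuous_intros\<close>)

lemma continuous_mean_slope_along:
  assumes "continuous_on I \<gamma>" "continuous_on I \<delta>" "I \<subseteq> {0..1}"
  shows "continuous_on I (\<lambda>x. mean_slope x (\<gamma> x) (\<delta> x))"
proof -
  have "continuous_on I (\<lambda>x. (\<lambda>(x, t\<^sub>1, t\<^sub>2). mean_slope x t\<^sub>1 t\<^sub>2) (x, \<gamma> x, \<delta> x))"
    by (rule continuous_on_compose2[OF continuous_mean_slope])
       (use assms in \<open>auto intro!: continuous_intros\<close>)
  then show ?thesis by simp
qed

text \<open>
  The difference of two solutions satisfies a linear equation with the mean slope as its coefficient,
  so it is an explicit exponential. Uniqueness, monotonicity and differentiability of the flow in the
  initial value are all read off from this formula.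
\<close>
lemma solves_difference:
  assumes "solves {p..q} \<gamma>" "solves {p..q} \<delta>" "{p..q} \<subseteq> {0..1}" "x \<in> {p..q}"
  shows "\<delta> x - \<gamma> x = (\<delta> p - \<gamma> p) * exp (integral {p..x} (\<lambda>\<eta>. mean_slope \<eta> (\<gamma> \<eta>) (\<delta> \<eta>)))"
proof -
  define A where "A = (\<lambda>\<eta>. mean_slope \<eta> (\<gamma> \<eta>) (\<delta> \<eta>))"
  define E where "E = (\<lambda>x. exp (- integral {p..x} A))"
  have contA: "continuous_on {p..q} A" unfolding A_def
    using assms by (intro continuous_mean_slope_along solves_continuous) auto
  have "((\<lambda>x. (\<delta> x - \<gamma> x) * E x) has_real_derivative 0) (at x within {p..q})" if x: "x \<in> {p..q}" for x
  proof -
    have "((\<lambda>x. (\<delta> x - \<gamma> x) * E x) has_real_derivative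
        (\<alpha> (x, \<delta> x) - \<alpha> (x, \<gamma> x)) * E x + (E x * (- A x)) * (\<delta> x - \<gamma> x)) (at x within {p..q})"
      unfolding E_def using assms(1,2) x
      by (auto intro!: derivative_eq_intros integral_has_real_derivative[OF contA] simp: solves_def)
    also have "(\<alpha> (x, \<delta> x) - \<alpha> (x, \<gamma> x)) * E x + (E x * (- A x)) * (\<delta> x - \<gamma> x) = 0"
      using x assms(3) by (subst mean_slope) (auto simp: A_def)
    finally show ?thesis .
  qed
  then obtain c where "\<forall>x\<in>{p..q}. (\<delta> x - \<gamma> x) * E x = c"
    using has_field_derivative_zero_constant[of "{p..q}"] by blast
  then have "(\<delta> x - \<gamma> x) * E x = (\<delta> p - \<gamma> p) * E p" using assms(4) by force
  then show ?thesis by (simp add: E_def A_def exp_minus field_simps)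
qed

lemma solves_unique:
  assumes "solves {p..q} \<gamma>" "solves {p..q} \<delta>" "{p..q} \<subseteq> {0..1}"
    and "z \<in> {p..q}" "\<gamma> z = \<delta> z" "x \<in> {p..q}"
  shows "\<gamma> x = \<delta> x"
  using solves_difference[OF assms(1-3), of z] solves_difference[OF assms(1-3), of x] assms(4-) by simp

lemma slope_bound:
  obtains L where "0 \<le> L" "\<And>x t. x \<in> {0..1} \<Longrightarrow> \<bar>t\<bar> \<le> N \<Longrightarrow> \<bar>\<alpha>' (x, t)\<bar> \<le> L"
proof -
  have "compact (\<alpha>' ` ({0..1} \<times> {-N..N}))"
    by (intro compact_continuous_image continuous_on_subset[OF cont'] compact_Times) auto
  then obtain L where L: "\<And>y. y \<in> \<alpha>' ` ({0..1} \<times> {-N..N}) \<Longrightarrow> norm y \<le> L"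
    using compact_imp_bounded bounded_iff by metis
  have "\<bar>\<alpha>' (x, t)\<bar> \<le> L" if "x \<in> {0..1}" "\<bar>t\<bar> \<le> N" for x t
  proof -
    have "\<alpha>' (x, t) \<in> \<alpha>' ` ({0..1} \<times> {-N..N})" using that by (intro imageI) auto
    from L[OF this] show ?thesis by simp
  qed
  then have "\<And>x t. x \<in> {0..1} \<Longrightarrow> \<bar>t\<bar> \<le> N \<Longrightarrow> \<bar>\<alpha>' (x, t)\<bar> \<le> max L 0" by fastforce
  then show ?thesis using that[of "max L 0"] by auto
qed

lemma speed_lipschitz:
  assumes "\<And>x t. x \<in> {0..1} \<Longrightarrow> \<bar>t\<bar> \<le> N \<Longrightarrow> \<bar>\<alpha>' (x, t)\<bar> \<le> L"
    and "x \<in> {0..1}" "\<bar>t\<^sub>1\<bar> \<le> N" "\<bar>t\<^sub>2\<bar> \<le> N"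
  shows "\<bar>\<alpha> (x, t\<^sub>2) - \<alpha> (x, t\<^sub>1)\<bar> \<le> L * \<bar>t\<^sub>2 - t\<^sub>1\<bar>"
proof -
  have "norm (\<alpha> (x, t\<^sub>2) - \<alpha> (x, t\<^sub>1)) \<le> L * norm (t\<^sub>2 - t\<^sub>1)"
    by (rule field_differentiable_bound[of "{-N..N}" _ "\<lambda>t. \<alpha>' (x, t)"])
       (use assms in \<open>auto intro!: DERIV_subset[OF deriv]\<close>)
  then show ?thesis by simp
qed

lemma abs_integral_speed_le:
  assumes "continuous_on {0..1} \<gamma>" "x \<in> {0..1}"
  shows "\<bar>integral {0..x} (\<lambda>\<eta>. \<alpha> (\<eta>, \<gamma> \<eta>))\<bar> \<le> M * x"
proof -
  have "norm (integral {0..x} (\<lambda>\<eta>. \<alpha> (\<eta>, \<gamma> \<eta>))) \<le> M * (x - 0)"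
  proof (rule integral_bound)
    show "continuous_on {0..x} (\<lambda>\<eta>. \<alpha> (\<eta>, \<gamma> \<eta>))"
      using assms by (intro continuous_along cont continuous_on_subset[OF assms(1)]) auto
  qed (use assms in \<open>auto intro: bound\<close>)
  then show ?thesis by simp
qed

lemma M_nonneg: "0 \<le> M"
  using bound[of 0 0] by simp

text \<open>
  The iterates stay within distance \<open>M\<close> of \<open>s\<close>, so the Lipschitz constant of the field on a compact
  set serves for all of them.
\<close>
fun picard :: "real \<Rightarrow> nat \<Rightarrow> real \<Rightarrow> real" where
  "picard s 0 = (\<lambda>x. s)"
| "picard s (Suc n) = (\<lambda>x. s + integral {0..x} (\<lambda>\<eta>. \<alpha> (\<eta>, picard s n \<eta>)))"

lemma integral_equation_continuous:
  assumes "continuous_on {0..1} \<gamma>"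
  shows "continuous_on {0..1} (\<lambda>x. s + integral {0..x} (\<lambda>\<eta>. \<alpha> (\<eta>, \<gamma> \<eta>)))"
  by (intro continuous_intros indefinite_integral_continuous_1 integrable_continuous_interval
      continuous_along assms cont) auto

lemma picard_continuous: "continuous_on {0..1} (picard s n)"
  by (induction n) (auto intro!: integral_equation_continuous)

lemma picard_bound: "x \<in> {0..1} \<Longrightarrow> \<bar>picard s n x\<bar> \<le> \<bar>s\<bar> + M"
proof (cases n)
  case (Suc m)
  assume x: "x \<in> {0..1}"
  have "M * x \<le> M" using x M_nonneg by (simp add: mult_left_le)
  with abs_integral_speed_le[OF picard_continuous x, of s m] Suc show ?thesis by auto
qed (use M_nonneg in auto)

text \<open>
  In the norm weighted by \<open>exp (2 * L * x)\<close> the Picard map contracts by the factor \<open>1 / 2\<close>: the weight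
  integrates to \<open>1 / (2 * L)\<close> times itself, up to a negative term. This covers the whole unit interval
  at once, without gluing of local solutions.
\<close>
lemma picard_step:
  assumes L: "0 \<le> L" "\<And>x t. x \<in> {0..1} \<Longrightarrow> \<bar>t\<bar> \<le> \<bar>s\<bar> + M \<Longrightarrow> \<bar>\<alpha>' (x, t)\<bar> \<le> L"
    and x: "x \<in> {0..1}"
  shows "\<bar>picard s (Suc n) x - picard s n x\<bar> \<le> M * exp (2 * L * x) * (1 / 2) ^ n"
  using x
proof (induction n arbitrary: x)
  case 0
  have "M * x \<le> M * exp (2 * L * x)"
    using M_nonneg 0 L(1) by (intro mult_left_mono) (auto intro: order_trans[of _ 1])
  with abs_integral_speed_le[OF picard_continuous[of s 0] 0] show ?case by auto
next
  case (Suc n)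
  have i: "(\<lambda>\<eta>. \<alpha> (\<eta>, picard s k \<eta>)) integrable_on {0..x}" for k
    using Suc.prems by (intro integrable_continuous_interval continuous_along cont
        continuous_on_subset[OF picard_continuous]) auto
  have "picard s (Suc (Suc n)) x - picard s (Suc n) x
     = integral {0..x} (\<lambda>\<eta>. \<alpha> (\<eta>, picard s (Suc n) \<eta>) - \<alpha> (\<eta>, picard s n \<eta>))"
    using integral_diff[OF i[of "Suc n"] i[of n]] by simp
  also have "norm \<dots> \<le> integral {0..x} (\<lambda>\<eta>. M * (L * exp (2 * L * \<eta>)) * (1 / 2) ^ n)"
  proof (rule integral_norm_bound_integral)
    fix \<eta> assume "\<eta> \<in> {0..x}"
    then have \<eta>: "\<eta> \<in> {0..1}" using Suc.prems by auto
    have "\<bar>\<alpha> (\<eta>, picard s (Suc n) \<eta>) - \<alpha> (\<eta>, picard s n \<eta>)\<bar>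
        \<le> L * \<bar>picard s (Suc n) \<eta> - picard s n \<eta>\<bar>"
      by (rule speed_lipschitz[OF L(2) \<eta> picard_bound picard_bound]) (use \<eta> in auto)
    also have "\<dots> \<le> L * (M * exp (2 * L * \<eta>) * (1 / 2) ^ n)"
      by (intro mult_left_mono Suc.IH \<eta> L(1))
    finally show "norm (\<alpha> (\<eta>, picard s (Suc n) \<eta>) - \<alpha> (\<eta>, picard s n \<eta>))
        \<le> M * (L * exp (2 * L * \<eta>)) * (1 / 2) ^ n"
      by (simp add: mult_ac)
  qed (intro integrable_diff i integrable_continuous_interval continuous_intros)+
  also have "\<dots> = M * ((exp (2 * L * x) - 1) / 2) * (1 / 2) ^ n"
  proof -
    have "((\<lambda>\<eta>. L * exp (2 * L * \<eta>)) has_integral (exp (2 * L * x) / 2 - exp (2 * L * 0) / 2)) {0..x}"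
      using Suc.prems
      by (intro fundamental_theorem_of_calculus)
         (auto simp: has_real_derivative_iff_has_vector_derivative[symmetric]
           intro!: derivative_eq_intros)
    from integral_unique[OF this] show ?thesis by (simp add: diff_divide_distrib)
  qed
  also have "\<dots> \<le> M * exp (2 * L * x) * (1 / 2) ^ Suc n"
    using M_nonneg by (simp add: mult_left_mono mult_right_mono divide_right_mono)
  finally show ?case by simp
qed

lemma solution_exists: "\<exists>\<gamma>. \<gamma> 0 = s \<and> solves {0..1} \<gamma>"
proof -
  obtain L where L: "0 \<le> L" "\<And>x t. x \<in> {0..1} \<Longrightarrow> \<bar>t\<bar> \<le> \<bar>s\<bar> + M \<Longrightarrow> \<bar>\<alpha>' (x, t)\<bar> \<le> L"
    using slope_bound by blast
  define d where "d = (\<lambda>n x. picard s (Suc n) x - picard s n x)"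
  have "norm (d n x) \<le> M * exp (2 * L) * (1 / 2) ^ n" if "x \<in> {0..1}" for n x
  proof -
    have "M * exp (2 * L * x) * (1 / 2) ^ n \<le> M * exp (2 * L) * (1 / 2) ^ n"
      using that L(1) M_nonneg by (intro mult_right_mono mult_left_mono) (auto simp: mult_left_le)
    with picard_step[where s = s and n = n, OF L that] show ?thesis by (simp add: d_def)
  qed
  moreover have "summable (\<lambda>n. M * exp (2 * L) * (1 / 2 :: real) ^ n)"
    by (intro summable_mult summable_geometric) auto
  ultimately have "uniform_limit {0..1} (\<lambda>n x. \<Sum>i<n. d i x) (\<lambda>x. suminf (\<lambda>i. d i x)) sequentially"
    by (rule Weierstrass_m_test)
  moreover have "(\<Sum>i<n. d i x) = picard s n x - s" for n x
    unfolding d_def by (subst sum_lessThan_telescope) simp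
  ultimately have lim: "uniform_limit {0..1} (\<lambda>n x. picard s n x - s) (\<lambda>x. suminf (\<lambda>i. d i x)) sequentially"
    by simp
  define \<gamma> where "\<gamma> = (\<lambda>x. s + suminf (\<lambda>i. d i x))"
  have ulim: "uniform_limit {0..1} (picard s) \<gamma> sequentially"
    using uniform_limit_add[OF uniform_limit_const lim, of "\<lambda>_. s"] by (simp add: \<gamma>_def)
  then have cont\<gamma>: "continuous_on {0..1} \<gamma>"
    by (rule uniform_limit_theorem[rotated]) (auto intro!: always_eventually picard_continuous)
  have lim_pt: "(\<lambda>n. picard s n x) \<longlonglongrightarrow> \<gamma> x" if "x \<in> {0..1}" for x
    using tendsto_uniform_limitI[OF ulim that] .
  have \<gamma>_bound: "\<bar>\<gamma> x\<bar> \<le> \<bar>s\<bar> + M" if "x \<in> {0..1}" for x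
    by (rule LIMSEQ_le_const2[OF tendsto_rabs[OF lim_pt[OF that]]]) (use picard_bound that in blast)
  have eq: "\<gamma> x = s + integral {0..x} (\<lambda>\<eta>. \<alpha> (\<eta>, \<gamma> \<eta>))" if x: "x \<in> {0..1}" for x
  proof -
    have "(\<lambda>n. picard s (Suc n) x) \<longlonglongrightarrow> s + integral {0..x} (\<lambda>\<eta>. \<alpha> (\<eta>, \<gamma> \<eta>))"
    proof (rule metric_LIMSEQ_I)
      fix e :: real assume e: "0 < e"
      have "\<forall>\<^sub>F n in sequentially. \<forall>y\<in>{0..1}. dist (picard s n y) (\<gamma> y) < e / (L + 1)"
        using uniform_limitD[OF ulim, of "e / (L + 1)"] e L(1) by simp
      then obtain N where N: "\<And>n y. n \<ge> N \<Longrightarrow> y \<in> {0..1} \<Longrightarrow> dist (picard s n y) (\<gamma> y) < e / (L + 1)"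
        unfolding eventually_sequentially by blast
      have "dist (picard s (Suc n) x) (s + integral {0..x} (\<lambda>\<eta>. \<alpha> (\<eta>, \<gamma> \<eta>))) < e" if "n \<ge> N" for n
      proof -
        have i: "continuous_on {0..x} (\<lambda>\<eta>. \<alpha> (\<eta>, \<delta> \<eta>))" if "continuous_on {0..1} \<delta>" for \<delta>
          using x that by (intro continuous_along cont continuous_on_subset[OF that]) auto
        note ii = integrable_continuous_interval[OF i]
        have "dist (picard s (Suc n) x) (s + integral {0..x} (\<lambda>\<eta>. \<alpha> (\<eta>, \<gamma> \<eta>)))
          = norm (integral {0..x} (\<lambda>\<eta>. \<alpha> (\<eta>, picard s n \<eta>) - \<alpha> (\<eta>, \<gamma> \<eta>)))"
          using integral_diff[OF ii[OF picard_continuous] ii[OF cont\<gamma>], of s n]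
          by (simp add: dist_norm)
        also have "\<dots> \<le> (L * (e / (L + 1))) * (x - 0)"
        proof (rule integral_bound)
          fix \<eta> assume "\<eta> \<in> {0..x}"
          then have \<eta>: "\<eta> \<in> {0..1}" using x by auto
          have "\<bar>\<alpha> (\<eta>, picard s n \<eta>) - \<alpha> (\<eta>, \<gamma> \<eta>)\<bar> \<le> L * \<bar>picard s n \<eta> - \<gamma> \<eta>\<bar>"
            by (rule speed_lipschitz[OF L(2) \<eta> \<gamma>_bound picard_bound]) (use \<eta> in auto)
          also have "\<dots> \<le> L * (e / (L + 1))"
            using N[OF that \<eta>] L(1) by (intro mult_left_mono) (auto simp: dist_norm)
          finally show "norm (\<alpha> (\<eta>, picard s n \<eta>) - \<alpha> (\<eta>, \<gamma> \<eta>)) \<le> L * (e / (L + 1))" by simp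
        qed (use x in \<open>auto intro!: continuous_intros i picard_continuous cont\<gamma>\<close>)
        also have "\<dots> \<le> L * (e / (L + 1)) * 1"
          using x L(1) e by (intro mult_left_mono) auto
        also have "\<dots> < e" using L(1) e by (simp add: field_simps)
        finally show ?thesis .
      qed
      then show "\<exists>N. \<forall>n\<ge>N. dist (picard s (Suc n) x) (s + integral {0..x} (\<lambda>\<eta>. \<alpha> (\<eta>, \<gamma> \<eta>))) < e"
        by blast
    qed
    moreover have "(\<lambda>n. picard s (Suc n) x) \<longlonglongrightarrow> \<gamma> x"
      using lim_pt[OF x] by (rule LIMSEQ_Suc)
    ultimately show ?thesis using LIMSEQ_unique by blast
  qed
  have "solves {0..1} \<gamma>" unfolding solves_def
  proof
    fix x :: real assume x: "x \<in> {0..1}"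
    have "((\<lambda>x. s + integral {0..x} (\<lambda>\<eta>. \<alpha> (\<eta>, \<gamma> \<eta>))) has_real_derivative 0 + \<alpha> (x, \<gamma> x)) (at x within {0..1})"
      by (intro DERIV_add DERIV_const integral_has_real_derivative continuous_along cont cont\<gamma> x) auto
    then show "(\<gamma> has_real_derivative \<alpha> (x, \<gamma> x)) (at x within {0..1})"
      by (auto intro: has_field_derivative_transform_within[OF _ zero_less_one x] simp: eq)
  qed
  moreover have "\<gamma> 0 = s" using eq[of 0] by simp
  ultimately show ?thesis by blast
qed

text \<open>
  The value at \<open>x\<close> of the characteristic that has height \<open>s\<close> at \<open>x = 0\<close>; the number \<open>s\<close> is called the
  label of the characteristic.
\<close>
definition \<Phi> :: "real \<Rightarrow> real \<Rightarrow> real" where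
  "\<Phi> x s = (SOME \<gamma>. \<gamma> 0 = s \<and> solves {0..1} \<gamma>) x"

lemma \<Phi>_start [simp]: "\<Phi> 0 s = s"
  and \<Phi>_solves: "solves {0..1} (\<lambda>x. \<Phi> x s)"
  unfolding \<Phi>_def using someI_ex[OF solution_exists[of s]] by auto

lemma \<Phi>_deriv:
  "x \<in> {0..1} \<Longrightarrow> ((\<lambda>x. \<Phi> x s) has_real_derivative \<alpha> (x, \<Phi> x s)) (at x within {0..1})"
  using \<Phi>_solves[of s] by (simp add: solves_def)

lemma \<Phi>_continuous_fst: "continuous_on {0..1} (\<lambda>x. \<Phi> x s)"
  using solves_continuous[OF \<Phi>_solves] .

lemma \<Phi>_lipschitz_fst:
  assumes "x \<in> {0..1}" "y \<in> {0..1}"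
  shows "\<bar>\<Phi> x s - \<Phi> y s\<bar> \<le> M * \<bar>x - y\<bar>"
proof -
  have "norm (\<Phi> x s - \<Phi> y s) \<le> M * norm (x - y)"
    by (rule field_differentiable_bound[of "{0..1}" _ "\<lambda>x. \<alpha> (x, \<Phi> x s)"])
       (use assms in \<open>auto intro!: \<Phi>_deriv bound\<close>)
  then show ?thesis by simp
qed

lemma \<Phi>_near_label: "x \<in> {0..1} \<Longrightarrow> \<bar>\<Phi> x s - s\<bar> \<le> M"
  using \<Phi>_lipschitz_fst[of x 0 s] M_nonneg mult_left_le[of x M] by (auto simp: mult.commute)

text \<open>
  The difference quotient of \<open>\<Phi> x\<close> between two labels. Its value for equal labels is the derivative
  \<open>\<Phi>'\<close> below.
\<close>
definition spread :: "real \<Rightarrow> real \<Rightarrow> real \<Rightarrow> real" where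
  "spread x s\<^sub>1 s\<^sub>2 = exp (integral {0..x} (\<lambda>\<eta>. mean_slope \<eta> (\<Phi> \<eta> s\<^sub>1) (\<Phi> \<eta> s\<^sub>2)))"

lemma \<Phi>_difference:
  "x \<in> {0..1} \<Longrightarrow> \<Phi> x s\<^sub>2 - \<Phi> x s\<^sub>1 = (s\<^sub>2 - s\<^sub>1) * spread x s\<^sub>1 s\<^sub>2"
  using solves_difference[OF \<Phi>_solves \<Phi>_solves, of x s\<^sub>2 s\<^sub>1] by (simp add: spread_def)

lemma spread_pos [simp]: "0 < spread x s\<^sub>1 s\<^sub>2"
  by (simp add: spread_def)

lemma \<Phi>_less_iff: "x \<in> {0..1} \<Longrightarrow> \<Phi> x s\<^sub>1 < \<Phi> x s\<^sub>2 \<longleftrightarrow> s\<^sub>1 < s\<^sub>2"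
  using \<Phi>_difference[of x s\<^sub>2 s\<^sub>1] spread_pos[of x s\<^sub>1 s\<^sub>2]
  by (metis diff_gt_0_iff_gt zero_less_mult_pos2 mult_pos_pos)

lemma \<Phi>_inj: "x \<in> {0..1} \<Longrightarrow> \<Phi> x s\<^sub>1 = \<Phi> x s\<^sub>2 \<longleftrightarrow> s\<^sub>1 = s\<^sub>2"
  using \<Phi>_less_iff[of x s\<^sub>1 s\<^sub>2] \<Phi>_less_iff[of x s\<^sub>2 s\<^sub>1] by (metis linorder_neq_iff)

lemma abs_mean_slope_le:
  assumes L: "\<And>t. \<bar>t\<bar> \<le> N \<Longrightarrow> \<bar>\<alpha>' (x, t)\<bar> \<le> L" and x: "x \<in> {0..1}"
    and t: "\<bar>t\<^sub>1\<bar> \<le> N" "\<bar>t\<^sub>2\<bar> \<le> N"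
  shows "\<bar>mean_slope x t\<^sub>1 t\<^sub>2\<bar> \<le> L"
proof -
  have "norm (mean_slope x t\<^sub>1 t\<^sub>2) \<le> L * (1 - 0)" unfolding mean_slope_def
  proof (rule integral_bound)
    fix \<theta> :: real assume \<theta>: "\<theta> \<in> {0..1}"
    have "(1 - \<theta>) *\<^sub>R t\<^sub>1 + \<theta> *\<^sub>R t\<^sub>2 \<in> {-N..N}"
      by (rule convexD[of "{-N..N}"]) (use \<theta> t in auto)
    then show "norm (\<alpha>' (x, t\<^sub>1 + \<theta> * (t\<^sub>2 - t\<^sub>1))) \<le> L"
      by (auto intro!: L simp: algebra_simps)
  next
    show "continuous_on {0..1} (\<lambda>\<theta>. \<alpha>' (x, t\<^sub>1 + \<theta> * (t\<^sub>2 - t\<^sub>1)))"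
      by (rule continuous_on_compose2[OF cont']) (use x in \<open>auto intro!: continuous_intros\<close>)
  qed simp
  then show ?thesis by simp
qed

text \<open>
  A local Lipschitz bound in the label, needed to establish joint continuity of \<open>\<Phi>\<close> before \<open>spread\<close>
  is known to be continuous.
\<close>
lemma spread_bounded:
  obtains B where "0 < B"
    "\<And>x s\<^sub>1 s\<^sub>2. x \<in> {0..1} \<Longrightarrow> \<bar>s\<^sub>1\<bar> \<le> N \<Longrightarrow> \<bar>s\<^sub>2\<bar> \<le> N \<Longrightarrow> spread x s\<^sub>1 s\<^sub>2 \<le> B"
proof -
  obtain L where L: "0 \<le> L" "\<And>x t. x \<in> {0..1} \<Longrightarrow> \<bar>t\<bar> \<le> N + M \<Longrightarrow> \<bar>\<alpha>' (x, t)\<bar> \<le> L"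
    using slope_bound by blast
  have "spread x s\<^sub>1 s\<^sub>2 \<le> exp L" if x: "x \<in> {0..1}" and s: "\<bar>s\<^sub>1\<bar> \<le> N" "\<bar>s\<^sub>2\<bar> \<le> N" for x s\<^sub>1 s\<^sub>2
  proof -
    have \<Phi>N: "\<bar>\<Phi> \<eta> s\<bar> \<le> N + M" if "\<eta> \<in> {0..1}" "\<bar>s\<bar> \<le> N" for \<eta> s
      using \<Phi>_near_label[of \<eta> s] that by simp
    have "norm (integral {0..x} (\<lambda>\<eta>. mean_slope \<eta> (\<Phi> \<eta> s\<^sub>1) (\<Phi> \<eta> s\<^sub>2))) \<le> L * (x - 0)"
    proof (rule integral_bound)
      show "continuous_on {0..x} (\<lambda>\<eta>. mean_slope \<eta> (\<Phi> \<eta> s\<^sub>1) (\<Phi> \<eta> s\<^sub>2))"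
        using x by (intro continuous_mean_slope_along continuous_on_subset[OF \<Phi>_continuous_fst]) auto
      show "norm (mean_slope \<eta> (\<Phi> \<eta> s\<^sub>1) (\<Phi> \<eta> s\<^sub>2)) \<le> L" if "\<eta> \<in> {0..x}" for \<eta>
        unfolding real_norm_def
        by (rule abs_mean_slope_le[OF L(2) _ \<Phi>N \<Phi>N]) (use that x s in auto)
    qed (use x in auto)
    also have "L * (x - 0) \<le> L" using x L(1) by (simp add: mult_left_le)
    finally show ?thesis by (simp add: spread_def)
  qed
  then show ?thesis using that[of "exp L"] by simp
qed

lemma \<Phi>_continuous: "continuous_on ({0..1} \<times> UNIV) (\<lambda>(x, s). \<Phi> x s)"
proof -
  have "\<exists>d>0. \<forall>y r. 0 \<le> y \<and> y \<le> 1 \<longrightarrow> dist (y, r) (x, s) < d \<longrightarrow> dist (\<Phi> y r) (\<Phi> x s) < e"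
    if x: "0 \<le> x" "x \<le> 1" and e: "0 < e" for x s e :: real
  proof -
  obtain B where B: "0 < B" "\<And>x s\<^sub>1 s\<^sub>2. x \<in> {0..1} \<Longrightarrow> \<bar>s\<^sub>1\<bar> \<le> \<bar>s\<bar> + 1 \<Longrightarrow> \<bar>s\<^sub>2\<bar> \<le> \<bar>s\<bar> + 1 \<Longrightarrow> spread x s\<^sub>1 s\<^sub>2 \<le> B"
    using spread_bounded by blast
  define d where "d = min 1 (e / (M + B + 1))"
  have MB: "0 < M + B + 1" using M_nonneg B(1) by simp
  have d: "0 < d" "d \<le> 1" "(M + B) * d < e"
  proof -
    show "0 < d" "d \<le> 1" using e MB by (auto simp: d_def)
    have "(M + B) * d < (M + B + 1) * d" using \<open>0 < d\<close> by (intro mult_strict_right_mono) auto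
    also have "\<dots> \<le> (M + B + 1) * (e / (M + B + 1))" using MB by (intro mult_left_mono) (auto simp: d_def)
    also have "\<dots> = e" using MB by simp
    finally show "(M + B) * d < e" .
  qed
  have "dist (\<Phi> y r) (\<Phi> x s) < e" if y: "0 \<le> y \<and> y \<le> 1" and near: "dist (y, r) (x, s) < d" for y r
  proof -
    have yx: "\<bar>y - x\<bar> < d" and rs: "\<bar>r - s\<bar> < d"
      using near dist_fst_le[of "(y, r)" "(x, s)"] dist_snd_le[of "(y, r)" "(x, s)"]
      by (auto simp: dist_real_def)
    have "\<bar>\<Phi> y r - \<Phi> y s\<bar> = \<bar>r - s\<bar> * spread y s r"
      using y by (simp add: \<Phi>_difference abs_mult abs_of_pos)
    also have "\<dots> \<le> d * B"
      using y rs d(2) B(1) by (intro mult_mono B(2)) (auto intro: less_imp_le)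
    finally have 1: "\<bar>\<Phi> y r - \<Phi> y s\<bar> \<le> d * B" .
    have "\<bar>\<Phi> y s - \<Phi> x s\<bar> \<le> M * \<bar>y - x\<bar>" using y x by (intro \<Phi>_lipschitz_fst) auto
    also have "\<dots> \<le> M * d" using yx M_nonneg by (intro mult_left_mono) auto
    finally have "\<bar>\<Phi> y r - \<Phi> x s\<bar> \<le> (M + B) * d" using 1 by (simp add: algebra_simps)
    with d(3) show ?thesis by (simp add: dist_real_def)
  qed
  then show ?thesis
    using d(1) by blast
  qed
  then show ?thesis by (simp add: continuous_on_iff split_beta split_paired_all Ball_def)
qed

lemma spread_continuous:
  "continuous_on (UNIV \<times> {0..1}) (\<lambda>(q, x). spread x (fst q) (snd q))"
proof -
  have \<Phi>c: "continuous_on (UNIV \<times> {0..1::real}) (\<lambda>z :: (real \<times> real) \<times> real. \<Phi> (snd z) (f (fst z)))"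
    if "continuous_on UNIV f" for f
  proof -
    have "continuous_on (UNIV \<times> {0..1::real}) (\<lambda>z :: (real \<times> real) \<times> real. (\<lambda>(x, s). \<Phi> x s) (snd z, f (fst z)))"
      by (rule continuous_on_compose2[OF \<Phi>_continuous])
         (auto intro!: continuous_intros continuous_on_compose2[OF that])
    then show ?thesis by simp
  qed
  have "continuous_on (UNIV \<times> {0..1::real}) (\<lambda>z :: (real \<times> real) \<times> real.
      (\<lambda>(x, t\<^sub>1, t\<^sub>2). mean_slope x t\<^sub>1 t\<^sub>2) (snd z, \<Phi> (snd z) (fst (fst z)), \<Phi> (snd z) (snd (fst z))))"
    by (rule continuous_on_compose2[OF continuous_mean_slope])
       (auto intro!: continuous_intros \<Phi>c)
  then have "continuous_on (UNIV \<times> {0..1::real}) (\<lambda>(q :: real \<times> real, y).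
      mean_slope y (\<Phi> y (fst q)) (\<Phi> y (snd q)))"
    by (simp add: split_beta)
  from continuous_on_exp[OF continuous_on_integral_upper_limit[OF this, where c = 0]]
  show ?thesis by (simp add: spread_def split_beta)
qed

definition \<Phi>' :: "real \<Rightarrow> real \<Rightarrow> real" where
  "\<Phi>' x s = exp (integral {0..x} (\<lambda>\<eta>. \<alpha>' (\<eta>, \<Phi> \<eta> s)))"

lemma spread_self: "spread x s s = \<Phi>' x s"
  by (simp add: spread_def \<Phi>'_def)

lemma \<Phi>'_pos [simp]: "0 < \<Phi>' x s"
  by (simp add: \<Phi>'_def)

lemma \<Phi>'_continuous: "continuous_on ({0..1} \<times> UNIV) (\<lambda>(x, s). \<Phi>' x s)"
proof -
  have "continuous_on ({0..1} \<times> UNIV) (\<lambda>z. (\<lambda>(q, x). spread x (fst q) (snd q)) ((snd z, snd z), fst z))"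
    by (rule continuous_on_compose2[OF spread_continuous]) (auto intro!: continuous_intros)
  then show ?thesis by (simp add: spread_self split_beta)
qed

text \<open>
  By Caratheodory's criterion, since \<open>spread\<close> is a difference quotient that is continuous up to
  the diagonal.
\<close>
lemma \<Phi>_deriv_label:
  assumes "x \<in> {0..1}"
  shows "((\<lambda>s. \<Phi> x s) has_real_derivative \<Phi>' x s) (at s)"
  unfolding CARAT_DERIV
proof (intro exI conjI allI)
  show "\<Phi> x r - \<Phi> x s = spread x s r * (r - s)" for r
    using \<Phi>_difference[OF assms, of r s] by (simp add: mult.commute)
  have "continuous_on UNIV (\<lambda>r. (\<lambda>(q, x). spread x (fst q) (snd q)) ((s, r), x))"
    by (rule continuous_on_compose2[OF spread_continuous]) (use assms in \<open>auto intro!: continuous_intros\<close>)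
  then show "isCont (\<lambda>r. spread x s r) s"
    by (simp add: continuous_on_eq_continuous_at)
qed (simp add: spread_self)

lemma \<Phi>'_deriv:
  assumes "x \<in> {0..1}"
  shows "((\<lambda>x. \<Phi>' x s) has_real_derivative \<alpha>' (x, \<Phi> x s) * \<Phi>' x s) (at x within {0..1})"
  unfolding \<Phi>'_def
  using assms by (auto intro!: derivative_eq_intros integral_has_real_derivative
      continuous_along cont' \<Phi>_continuous_fst)

lemma \<Phi>_surj:
  assumes "x \<in> {0..1}"
  shows "\<exists>s. \<Phi> x s = t"
proof -
  have "\<exists>s\<ge>t - M. s \<le> t + M \<and> \<Phi> x s = t"
  proof (rule IVT)
    show "\<Phi> x (t - M) \<le> t" using \<Phi>_near_label[OF assms, of "t - M"] by linarith
    show "t \<le> \<Phi> x (t + M)" using \<Phi>_near_label[OF assms, of "t + M"] by linarith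
    show "t - M \<le> t + M" using M_nonneg by simp
    show "\<forall>s. t - M \<le> s \<and> s \<le> t + M \<longrightarrow> isCont (\<Phi> x) s"
      using \<Phi>_deriv_label[OF assms] DERIV_isCont by blast
  qed
  then show ?thesis by blast
qed

text \<open>
  The label of the characteristic through \<open>(x, t)\<close>.
\<close>
definition \<Lambda> :: "real \<Rightarrow> real \<Rightarrow> real" where
  "\<Lambda> x t = (SOME s. \<Phi> x s = t)"

lemma \<Phi>_\<Lambda> [simp]: "x \<in> {0..1} \<Longrightarrow> \<Phi> x (\<Lambda> x t) = t"
  unfolding \<Lambda>_def using someI_ex[OF \<Phi>_surj] .

lemma \<Lambda>_\<Phi> [simp]: "x \<in> {0..1} \<Longrightarrow> \<Lambda> x (\<Phi> x s) = s"
  using \<Phi>_\<Lambda>[of x "\<Phi> x s"] \<Phi>_inj by blast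

lemma \<Lambda>_near: "x \<in> {0..1} \<Longrightarrow> \<bar>\<Lambda> x t - t\<bar> \<le> M"
  using \<Phi>_near_label[of x "\<Lambda> x t"] by (simp add: abs_minus_commute)

text \<open>
  Strict monotonicity of \<open>\<Phi> x\<close> turns inequalities for labels into inequalities for heights, which are
  open conditions on \<open>(x, t)\<close>.
\<close>
lemma \<Lambda>_continuous: "continuous_on ({0..1} \<times> UNIV) (\<lambda>(x, t). \<Lambda> x t)"
proof -
  have "((\<lambda>(x, t). \<Lambda> x t) \<longlongrightarrow> \<Lambda> x\<^sub>0 t\<^sub>0) (at (x\<^sub>0, t\<^sub>0) within {0..1} \<times> UNIV)"
    if x0: "x\<^sub>0 \<in> {0..1}" for x\<^sub>0 t\<^sub>0
  proof -
    let ?F = "at (x\<^sub>0, t\<^sub>0) within {0..1} \<times> UNIV"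
    have lim: "((\<lambda>z. \<Phi> (fst z) s - snd z) \<longlongrightarrow> \<Phi> x\<^sub>0 s - t\<^sub>0) ?F" for s
    proof -
      have "continuous_on ({0..1} \<times> UNIV) (\<lambda>z. \<Phi> (fst z) s - snd z)"
        by (intro continuous_intros continuous_on_compose2[OF \<Phi>_continuous_fst]) auto
      then show ?thesis using x0 unfolding continuous_on_def by force
    qed
    have mem: "\<forall>\<^sub>F z in ?F. fst z \<in> {0..1}"
      unfolding eventually_at_filter by (auto intro: always_eventually)
    show ?thesis
    proof (rule order_tendstoI)
      fix s assume "s < \<Lambda> x\<^sub>0 t\<^sub>0"
      then have "\<Phi> x\<^sub>0 s - t\<^sub>0 < 0" using x0 \<Phi>_less_iff[of x\<^sub>0 s "\<Lambda> x\<^sub>0 t\<^sub>0"] by simp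
      from eventually_conj[OF mem order_tendstoD(2)[OF lim this]]
      show "\<forall>\<^sub>F z in ?F. s < (\<lambda>(x, t). \<Lambda> x t) z"
        by (rule eventually_mono) (use \<Phi>_less_iff[of _ s] in \<open>fastforce simp: split_beta\<close>)
    next
      fix s assume "\<Lambda> x\<^sub>0 t\<^sub>0 < s"
      then have "0 < \<Phi> x\<^sub>0 s - t\<^sub>0" using x0 \<Phi>_less_iff[of x\<^sub>0 "\<Lambda> x\<^sub>0 t\<^sub>0" s] by simp
      from eventually_conj[OF mem order_tendstoD(1)[OF lim this]]
      show "\<forall>\<^sub>F z in ?F. (\<lambda>(x, t). \<Lambda> x t) z < s"
        by (rule eventually_mono) (use \<Phi>_less_iff[of _ _ s] in \<open>fastforce simp: split_beta\<close>)
    qed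
  qed
  then show ?thesis unfolding continuous_on_def by auto
qed

lemma \<Lambda>_deriv:
  assumes "x \<in> {0..1}"
  shows "((\<lambda>t. \<Lambda> x t) has_real_derivative inverse (\<Phi>' x (\<Lambda> x t))) (at t)"
proof (rule DERIV_inverse_function[where f = "\<Phi> x" and a = "t - 1" and b = "t + 1"])
  have "continuous_on UNIV (\<lambda>t. (\<lambda>(x, t). \<Lambda> x t) (x, t))"
    by (rule continuous_on_compose2[OF \<Lambda>_continuous]) (use assms in \<open>auto intro!: continuous_intros\<close>)
  then show "isCont (\<Lambda> x) t" by (simp add: continuous_on_eq_continuous_at)
  show "\<Phi>' x (\<Lambda> x t) \<noteq> 0" using \<Phi>'_pos[of x "\<Lambda> x t"] by linarith
qed (use assms \<Phi>_deriv_label in auto)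

end

section \<open>Functions differentiable in the time variable\<close>

definition slab :: "real \<Rightarrow> (real \<times> real) set" where
  "slab T = {0..1} \<times> {T..}"

lemma mem_slab [simp]: "(x, t) \<in> slab T \<longleftrightarrow> 0 \<le> x \<and> x \<le> 1 \<and> T \<le> t"
  by (auto simp: slab_def)

lemma slab_mono: "T \<le> T' \<Longrightarrow> slab T' \<subseteq> slab T"
  by (auto simp: slab_def)

lemma slab_subset_band: "slab T \<subseteq> {0..1} \<times> UNIV"
  by (auto simp: slab_def)

text \<open>
  The derivative at \<open>t = T\<close> is one-sided. In \<open>x\<close> only continuity is required, because all smoothing takes
  place in \<open>t\<close>; \<open>x\<close>-derivatives are recovered from the equations at the end.
\<close>
definition has_t_deriv :: "real \<Rightarrow> (real \<times> real \<Rightarrow> real) \<Rightarrow> (real \<times> real \<Rightarrow> real) \<Rightarrow> bool" where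
  "has_t_deriv T f f' \<longleftrightarrow> continuous_on (slab T) f \<and> continuous_on (slab T) f' \<and>
     (\<forall>x t. (x, t) \<in> slab T \<longrightarrow> ((\<lambda>\<tau>. f (x, \<tau>)) has_real_derivative f' (x, t)) (at t within {T..}))"

definition t_smooth :: "real \<Rightarrow> (real \<times> real \<Rightarrow> real) \<Rightarrow> bool" where
  "t_smooth T f \<longleftrightarrow> (\<exists>f'. has_t_deriv T f f')"

lemma has_t_derivD:
  assumes "has_t_deriv T f f'"
  shows "continuous_on (slab T) f" "continuous_on (slab T) f'"
    "x \<in> {0..1} \<Longrightarrow> T \<le> t \<Longrightarrow> ((\<lambda>\<tau>. f (x, \<tau>)) has_real_derivative f' (x, t)) (at t within {T..})"
  using assms by (auto simp: has_t_deriv_def)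

lemma has_t_deriv_imp_t_smooth: "has_t_deriv T f f' \<Longrightarrow> t_smooth T f"
  by (auto simp: t_smooth_def)

lemma has_t_deriv_mono:
  assumes "has_t_deriv T f f'" "T \<le> T'"
  shows "has_t_deriv T' f f'"
  unfolding has_t_deriv_def
proof (intro conjI allI impI)
  show "continuous_on (slab T') f" "continuous_on (slab T') f'"
    using has_t_derivD(1,2)[OF assms(1)] slab_mono[OF assms(2)] continuous_on_subset by blast+
  show "((\<lambda>\<tau>. f (x, \<tau>)) has_real_derivative f' (x, t)) (at t within {T'..})"
    if "(x, t) \<in> slab T'" for x t
    by (rule DERIV_subset[OF has_t_derivD(3)[OF assms(1)]]) (use that assms(2) in auto)
qed

lemma has_t_deriv_cong:
  assumes "has_t_deriv T f f'" "\<And>z. z \<in> slab T \<Longrightarrow> f z = g z" "\<And>z. z \<in> slab T \<Longrightarrow> f' z = g' z"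
  shows "has_t_deriv T g g'"
proof -
  have "((\<lambda>\<tau>. g (x, \<tau>)) has_real_derivative g' (x, t)) (at t within {T..})"
    if "(x, t) \<in> slab T" for x t
  proof -
    have "((\<lambda>\<tau>. f (x, \<tau>)) has_real_derivative g' (x, t)) (at t within {T..})"
      using assms that by (auto simp: has_t_deriv_def)
    then show ?thesis
      by (rule has_field_derivative_transform_within[OF _ zero_less_one]) (use that assms(2) in auto)
  qed
  moreover have "continuous_on (slab T) g" "continuous_on (slab T) g'"
    using assms continuous_on_cong[of "slab T" "slab T" f g] continuous_on_cong[of "slab T" "slab T" f' g']
    by (auto simp: has_t_deriv_def)
  ultimately show ?thesis by (auto simp: has_t_deriv_def)
qed

lemma has_t_deriv_unique:
  assumes "has_t_deriv T f f'" "has_t_deriv T f f''" "z \<in> slab T"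
  shows "f' z = f'' z"
proof -
  obtain x t where z: "z = (x, t)" "x \<in> {0..1}" "T \<le> t" using assms(3) by (cases z) auto
  have "((\<lambda>\<tau>. f (x, \<tau>)) has_real_derivative g (x, t)) (at_right t)" if "has_t_deriv T f g" for g
    by (rule DERIV_subset[OF has_t_derivD(3)[OF that z(2,3)]]) (use z(3) in auto)
  from this[OF assms(1)] this[OF assms(2)] show ?thesis
    using vector_derivative_unique_within[of t "{t<..}"]
    by (simp add: has_real_derivative_iff_has_vector_derivative z(1) trivial_limit_at_right_real)
qed

lemma has_t_deriv_const: "has_t_deriv T (\<lambda>z. c) (\<lambda>z. 0)"
  by (auto simp: has_t_deriv_def)

lemma has_t_deriv_add:
  "has_t_deriv T f f' \<Longrightarrow> has_t_deriv T g g' \<Longrightarrow> has_t_deriv T (\<lambda>z. f z + g z) (\<lambda>z. f' z + g' z)"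
  by (auto simp: has_t_deriv_def intro!: continuous_intros derivative_intros)

lemma has_t_deriv_diff:
  "has_t_deriv T f f' \<Longrightarrow> has_t_deriv T g g' \<Longrightarrow> has_t_deriv T (\<lambda>z. f z - g z) (\<lambda>z. f' z - g' z)"
  by (auto simp: has_t_deriv_def intro!: continuous_intros derivative_intros)

lemma has_t_deriv_mult:
  "has_t_deriv T f f' \<Longrightarrow> has_t_deriv T g g' \<Longrightarrow>
   has_t_deriv T (\<lambda>z. f z * g z) (\<lambda>z. f' z * g z + f z * g' z)"
  by (auto simp: has_t_deriv_def intro!: continuous_intros derivative_eq_intros)

lemma has_t_deriv_exp:
  "has_t_deriv T f f' \<Longrightarrow> has_t_deriv T (\<lambda>z. exp (f z)) (\<lambda>z. exp (f z) * f' z)"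
  by (auto simp: has_t_deriv_def intro!: continuous_intros derivative_eq_intros)

lemma has_t_deriv_sum:
  "(\<And>k. k \<in> I \<Longrightarrow> has_t_deriv T (f k) (f' k)) \<Longrightarrow>
   has_t_deriv T (\<lambda>z. \<Sum>k\<in>I. f k z) (\<lambda>z. \<Sum>k\<in>I. f' k z)"
  by (induction I rule: infinite_finite_induct) (auto intro: has_t_deriv_add has_t_deriv_const)

lemma has_t_deriv_freeze:
  assumes "has_t_deriv T f f'" "x\<^sub>0 \<in> {0..1}"
  shows "has_t_deriv T (\<lambda>z. f (x\<^sub>0, snd z)) (\<lambda>z. f' (x\<^sub>0, snd z))"
proof -
  have "continuous_on (slab T) (\<lambda>z. g (x\<^sub>0, snd z))" if "continuous_on (slab T) g" for g :: "real \<times> real \<Rightarrow> real"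
    by (rule continuous_on_compose2[OF that]) (use assms(2) in \<open>auto intro!: continuous_intros simp: slab_def\<close>)
  with assms show ?thesis by (auto simp: has_t_deriv_def)
qed

lemma has_t_deriv_integral:
  assumes "has_t_deriv T f f'"
  shows "has_t_deriv T (\<lambda>z. integral {0..fst z} (\<lambda>\<xi>. f (\<xi>, snd z)))
    (\<lambda>z. integral {0..fst z} (\<lambda>\<xi>. f' (\<xi>, snd z)))"
proof -
  have swap: "continuous_on ({T..} \<times> {0..1}) (\<lambda>(t, x). g (x, t))"
    if "continuous_on (slab T) g" for g :: "real \<times> real \<Rightarrow> real"
    unfolding split_beta
    by (rule continuous_on_compose2[OF that]) (auto intro!: continuous_intros)
  have c: "continuous_on (slab T) (\<lambda>z. integral {0..fst z} (\<lambda>\<xi>. g (\<xi>, snd z)))"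
    if "continuous_on (slab T) g" for g :: "real \<times> real \<Rightarrow> real"
  proof -
    have "continuous_on ({T..} \<times> {0..1}) (\<lambda>(t, x). integral {0..x} (\<lambda>\<xi>. g (\<xi>, t)))"
      by (rule continuous_on_integral_upper_limit[OF swap[OF that]]) auto
    then have "continuous_on (slab T) (\<lambda>z. (\<lambda>(t, x). integral {0..x} (\<lambda>\<xi>. g (\<xi>, t))) (snd z, fst z))"
      by (rule continuous_on_compose2) (auto simp: slab_def intro!: continuous_intros)
    then show ?thesis by simp
  qed
  have "((\<lambda>\<tau>. integral {0..x} (\<lambda>\<xi>. f (\<xi>, \<tau>))) has_real_derivative
      integral {0..x} (\<lambda>\<xi>. f' (\<xi>, t))) (at t within {T..})" if "(x, t) \<in> slab T" for x t
  proof -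
    have "((\<lambda>\<tau>. integral (cbox 0 x) (\<lambda>\<xi>. f (\<xi>, \<tau>))) has_real_derivative
      integral (cbox 0 x) (\<lambda>\<xi>. f' (\<xi>, t))) (at t within {T..})"
    proof (rule leibniz_rule_field_derivative)
      show "continuous_on ({T..} \<times> cbox 0 x) (\<lambda>(\<tau>, \<xi>). f' (\<xi>, \<tau>))"
        using that by (intro continuous_on_subset[OF swap[OF has_t_derivD(2)[OF assms]]]) auto
      fix \<tau> assume \<tau>: "\<tau> \<in> {T..}"
      have "continuous_on (cbox 0 x) (\<lambda>\<xi>. f (\<xi>, \<tau>))"
        by (rule continuous_on_compose2[OF has_t_derivD(1)[OF assms]])
           (use that \<tau> in \<open>auto intro!: continuous_intros simp: slab_def\<close>)
      then show "(\<lambda>\<xi>. f (\<xi>, \<tau>)) integrable_on cbox 0 x" by (rule integrable_continuous)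
      fix \<xi> assume "\<xi> \<in> cbox 0 x"
      then show "((\<lambda>\<tau>. f (\<xi>, \<tau>)) has_real_derivative f' (\<xi>, \<tau>)) (at \<tau> within {T..})"
        using that \<tau> by (intro has_t_derivD(3)[OF assms]) auto
    qed (use that in auto)
    then show ?thesis by simp
  qed
  with c assms show ?thesis by (auto simp: has_t_deriv_def)
qed

lemma has_t_deriv_antiderivative:
  assumes f: "continuous_on (slab T) f"
  shows "has_t_deriv T (\<lambda>z. integral {T..snd z} (\<lambda>\<tau>. f (fst z, \<tau>))) f"
proof -
  have "continuous_on (slab T) (\<lambda>(x, t). integral {T..t} (\<lambda>\<tau>. f (x, \<tau>)))"
    unfolding slab_def
    by (rule continuous_on_integral_upper_limit) (use f in \<open>auto simp: slab_def\<close>)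
  moreover have "((\<lambda>t. integral {T..t} (\<lambda>\<tau>. f (x, \<tau>))) has_real_derivative f (x, t)) (at t within {T..})"
    if "(x, t) \<in> slab T" for x t
    by (rule has_real_derivative_integral_atLeast)
       (use that in \<open>auto intro!: continuous_intros continuous_on_compose2[OF f]\<close>)
  ultimately show ?thesis using f by (auto simp: has_t_deriv_def split_beta)
qed

text \<open>
  Covers both changes between the coordinates \<open>(x, t)\<close> and \<open>(x, s)\<close> with the label \<open>s\<close>.
\<close>
lemma has_t_deriv_reparametrize:
  assumes f: "has_t_deriv T f f'"
    and \<kappa>: "continuous_on (slab S) (\<lambda>(x, s). \<kappa> x s)" "continuous_on (slab S) (\<lambda>(x, s). \<kappa>' x s)"
    and range: "\<And>x s. (x, s) \<in> slab S \<Longrightarrow> T \<le> \<kappa> x s"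
    and deriv: "\<And>x s. (x, s) \<in> slab S \<Longrightarrow> (\<kappa> x has_real_derivative \<kappa>' x s) (at s)"
  shows "has_t_deriv S (\<lambda>(x, s). f (x, \<kappa> x s)) (\<lambda>(x, s). f' (x, \<kappa> x s) * \<kappa>' x s)"
proof -
  have c: "continuous_on (slab S) (\<lambda>(x, s). g (x, \<kappa> x s))" if "continuous_on (slab T) g" for g :: "real \<times> real \<Rightarrow> real"
    unfolding split_beta
    by (rule continuous_on_compose2[OF that])
       (use \<kappa>(1) range in \<open>auto intro!: continuous_intros simp: split_beta slab_def\<close>)
  have "((\<lambda>s. f (x, \<kappa> x s)) has_real_derivative f' (x, \<kappa> x s) * \<kappa>' x s) (at s within {S..})"
    if z: "(x, s) \<in> slab S" for x s
  proof -
    have "((\<lambda>\<tau>. f (x, \<tau>)) has_real_derivative f' (x, \<kappa> x s)) (at (\<kappa> x s) within \<kappa> x ` {S..})"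
      by (rule DERIV_subset[OF has_t_derivD(3)[OF f]]) (use z range in auto)
    from DERIV_image_chain[OF this DERIV_subset[OF deriv[OF z]]] show ?thesis
      by (simp add: o_def)
  qed
  moreover have "continuous_on (slab S) (\<lambda>(x, s). f' (x, \<kappa> x s) * \<kappa>' x s)"
    using c[OF has_t_derivD(2)[OF f]] \<kappa>(2) by (auto simp: split_beta intro!: continuous_intros)
  ultimately show ?thesis using c[OF has_t_derivD(1)[OF f]] by (auto simp: has_t_deriv_def)
qed

lemma has_t_deriv_increment:
  assumes f: "has_t_deriv T f f'" and x: "x \<in> {0..1}" and t: "T \<le> t\<^sub>1" "T \<le> t\<^sub>2"
  shows "f (x, t\<^sub>2) - f (x, t\<^sub>1) = integral {0..1} (\<lambda>\<theta>. f' (x, t\<^sub>1 + \<theta> * (t\<^sub>2 - t\<^sub>1))) * (t\<^sub>2 - t\<^sub>1)"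
proof -
  have seg: "T \<le> t\<^sub>1 + \<theta> * (t\<^sub>2 - t\<^sub>1)" if "\<theta> \<in> {0..1}" for \<theta>
    using convexD[of "{T..}" t\<^sub>1 t\<^sub>2 "1 - \<theta>" \<theta>] that t by (auto simp: algebra_simps)
  have "((\<lambda>\<theta>. f (x, t\<^sub>1 + \<theta> * (t\<^sub>2 - t\<^sub>1))) has_real_derivative
      f' (x, t\<^sub>1 + \<theta> * (t\<^sub>2 - t\<^sub>1)) * (t\<^sub>2 - t\<^sub>1)) (at \<theta> within {0..1})" if \<theta>: "\<theta> \<in> {0..1}" for \<theta>
  proof -
    have outer: "((\<lambda>\<tau>. f (x, \<tau>)) has_real_derivative f' (x, t\<^sub>1 + \<theta> * (t\<^sub>2 - t\<^sub>1)))
       (at (t\<^sub>1 + \<theta> * (t\<^sub>2 - t\<^sub>1)) within (\<lambda>\<theta>. t\<^sub>1 + \<theta> * (t\<^sub>2 - t\<^sub>1)) ` {0..1})"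
      by (rule DERIV_subset[OF has_t_derivD(3)[OF f x]]) (use seg \<theta> in auto)
    have inner: "((\<lambda>\<theta>. t\<^sub>1 + \<theta> * (t\<^sub>2 - t\<^sub>1)) has_real_derivative t\<^sub>2 - t\<^sub>1) (at \<theta> within {0..1})"
      by (auto intro!: derivative_eq_intros)
    from DERIV_image_chain[OF outer inner] show ?thesis by (simp add: o_def)
  qed
  then have "((\<lambda>\<theta>. f' (x, t\<^sub>1 + \<theta> * (t\<^sub>2 - t\<^sub>1)) * (t\<^sub>2 - t\<^sub>1)) has_integral
      f (x, t\<^sub>1 + 1 * (t\<^sub>2 - t\<^sub>1)) - f (x, t\<^sub>1 + 0 * (t\<^sub>2 - t\<^sub>1))) {0..1}"
    by (intro fundamental_theorem_of_calculus)
       (auto simp: has_real_derivative_iff_has_vector_derivative)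
  from integral_unique[OF this] show ?thesis by simp
qed

text \<open>
  The product rule at a zero of \<open>h\<close> needs no differentiability of \<open>D\<close>: the term \<open>(D z - D p) * h z\<close> is
  of smaller order than \<open>z - p\<close>, as \<open>h z\<close> is already of that order.
\<close>
lemma has_derivative_mult_vanishing:
  fixes D h :: "'a::real_normed_vector \<Rightarrow> real"
  assumes D: "(D \<longlongrightarrow> D p) (at p within S)" and h: "(h has_derivative h') (at p within S)" and "h p = 0"
  shows "((\<lambda>z. D z * h z) has_derivative (\<lambda>v. D p * h' v)) (at p within S)"
proof -
  have bl: "bounded_linear h'" using h by (rule has_derivative_bounded_linear)
  obtain K where K: "0 < K" "\<And>v. norm (h' v) \<le> norm v * K" using bounded_linear.pos_bounded[OF bl] by blast
  define r where "r = (\<lambda>z. norm (h z - h p - h' (z - p)) / norm (z - p))"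
  have r: "(r \<longlongrightarrow> 0) (at p within S)" using h unfolding has_derivative_iff_norm r_def by simp
  have "((\<lambda>z. norm (D z * h z - D p * h p - D p * h' (z - p)) / norm (z - p)) \<longlongrightarrow> 0) (at p within S)"
  proof (rule Lim_null_comparison)
    have "((\<lambda>z. \<bar>D z\<bar> * r z + \<bar>D z - D p\<bar> * K) \<longlongrightarrow> \<bar>D p\<bar> * 0 + \<bar>D p - D p\<bar> * K) (at p within S)"
      by (intro tendsto_intros D r)
    then show "((\<lambda>z. \<bar>D z\<bar> * r z + \<bar>D z - D p\<bar> * K) \<longlongrightarrow> 0) (at p within S)"
      by simp
    show "\<forall>\<^sub>F z in at p within S. norm (norm (D z * h z - D p * h p - D p * h' (z - p)) / norm (z - p))
        \<le> \<bar>D z\<bar> * r z + \<bar>D z - D p\<bar> * K"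
    proof (rule always_eventually, rule allI)
      fix z
      show "norm (norm (D z * h z - D p * h p - D p * h' (z - p)) / norm (z - p))
        \<le> \<bar>D z\<bar> * r z + \<bar>D z - D p\<bar> * K"
      proof (cases "z = p")
        case False
        have "D z * h z - D p * h p - D p * h' (z - p)
          = D z * (h z - h p - h' (z - p)) + (D z - D p) * h' (z - p)"
          using assms(3) by (simp add: algebra_simps)
        then have "norm (D z * h z - D p * h p - D p * h' (z - p))
          \<le> \<bar>D z\<bar> * norm (h z - h p - h' (z - p)) + \<bar>D z - D p\<bar> * norm (h' (z - p))"
          using norm_triangle_ineq[of "D z * (h z - h p - h' (z - p))" "(D z - D p) * h' (z - p)"]
          by (simp add: abs_mult)
        also have "\<dots> \<le> \<bar>D z\<bar> * norm (h z - h p - h' (z - p)) + \<bar>D z - D p\<bar> * (norm (z - p) * K)"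
          by (intro add_left_mono mult_left_mono K(2)) auto
        also have "\<dots> = (\<bar>D z\<bar> * r z + \<bar>D z - D p\<bar> * K) * norm (z - p)"
          using False by (simp add: r_def distrib_right)
        finally show ?thesis using False by (simp add: divide_le_eq)
      qed (use K(1) in \<open>simp add: r_def\<close>)
    qed
  qed
  moreover have "bounded_linear (\<lambda>v. D p * h' v)"
    using bounded_linear_compose[OF bounded_linear_mult_right bl] .
  ultimately show ?thesis by (simp add: has_derivative_iff_norm)
qed

section \<open>Derivatives along characteristics\<close>

context char_flow begin

text \<open>
  \<open>along T w g\<close> expresses \<open>\<partial>\<^sub>x w + \<alpha> \<partial>\<^sub>t w = g\<close> for functions that need not have partial derivatives.
  Labels \<open>s \<ge> T + M\<close> are exactly those for which the bound \<open>M\<close> guarantees that the characteristic stays in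
  \<open>slab T\<close>; each passage between points and labels therefore costs a time \<open>M\<close>.
\<close>
definition along :: "real \<Rightarrow> (real \<times> real \<Rightarrow> real) \<Rightarrow> (real \<times> real \<Rightarrow> real) \<Rightarrow> bool" where
  "along T w g \<longleftrightarrow> (\<forall>s\<ge>T + M. \<forall>x\<in>{0..1}.
     ((\<lambda>x. w (x, \<Phi> x s)) has_real_derivative g (x, \<Phi> x s)) (at x within {0..1}))"

lemma alongD:
  "along T w g \<Longrightarrow> T + M \<le> s \<Longrightarrow> x \<in> {0..1} \<Longrightarrow>
   ((\<lambda>x. w (x, \<Phi> x s)) has_real_derivative g (x, \<Phi> x s)) (at x within {0..1})"
  by (simp add: along_def)

lemma \<Phi>_ge: "x \<in> {0..1} \<Longrightarrow> T + M \<le> s \<Longrightarrow> T \<le> \<Phi> x s"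
  using \<Phi>_near_label[of x s] by linarith

lemma \<Lambda>_ge: "x \<in> {0..1} \<Longrightarrow> T + M \<le> t \<Longrightarrow> T \<le> \<Lambda> x t"
  using \<Lambda>_near[of x t] by linarith

lemma along_mono: "along T w g \<Longrightarrow> T \<le> T' \<Longrightarrow> along T' w g"
  by (auto simp: along_def)

lemma along_cong:
  assumes "along T w g" "\<And>z. z \<in> slab T \<Longrightarrow> w z = w' z" "\<And>z. z \<in> slab T \<Longrightarrow> g z = g' z"
  shows "along T w' g'"
  unfolding along_def
proof (intro allI impI ballI)
  fix s x :: real assume s: "T + M \<le> s" and x: "x \<in> {0..1}"
  have slab: "(y, \<Phi> y s) \<in> slab T" if "y \<in> {0..1}" for y using \<Phi>_ge[OF that s] that by simp
  have "((\<lambda>x. w (x, \<Phi> x s)) has_real_derivative g' (x, \<Phi> x s)) (at x within {0..1})"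
    using alongD[OF assms(1) s x] assms(3)[OF slab[OF x]] by simp
  then show "((\<lambda>x. w' (x, \<Phi> x s)) has_real_derivative g' (x, \<Phi> x s)) (at x within {0..1})"
    by (rule has_field_derivative_transform_within[OF _ zero_less_one x]) (use assms(2) slab in auto)
qed

lemma along_add: "along T v f \<Longrightarrow> along T w g \<Longrightarrow> along T (\<lambda>z. v z + w z) (\<lambda>z. f z + g z)"
  by (auto simp: along_def intro!: derivative_intros)

lemma along_mult:
  "along T v f \<Longrightarrow> along T w g \<Longrightarrow> along T (\<lambda>z. v z * w z) (\<lambda>z. f z * w z + v z * g z)"
  by (auto simp: along_def intro!: derivative_eq_intros)

lemma along_const: "along T (\<lambda>z. c) (\<lambda>z. 0)"
  by (auto simp: along_def)

lemma along_sum: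
  "(\<And>k. k \<in> I \<Longrightarrow> along T (v k) (f k)) \<Longrightarrow> along T (\<lambda>z. \<Sum>k\<in>I. v k z) (\<lambda>z. \<Sum>k\<in>I. f k z)"
  by (induction I rule: infinite_finite_induct) (auto intro: along_add along_const)

lemma along_of_has_derivative:
  assumes "\<And>z. z \<in> slab T \<Longrightarrow> (w has_derivative (\<lambda>v. p z * fst v + q z * snd v)) (at z within slab T)"
  shows "along T w (\<lambda>z. p z + \<alpha> z * q z)"
  unfolding along_def
proof (intro allI impI ballI)
  fix s x :: real assume s: "T + M \<le> s" and x: "x \<in> {0..1}"
  have "((\<lambda>x. (x, \<Phi> x s)) has_derivative (\<lambda>h. (h, \<alpha> (x, \<Phi> x s) * h))) (at x within {0..1})"
    using \<Phi>_deriv[OF x, of s]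
    by (intro has_derivative_Pair has_derivative_ident) (simp add: has_field_derivative_def)
  then have "((\<lambda>x. w (x, \<Phi> x s)) has_derivative
      (\<lambda>h. p (x, \<Phi> x s) * fst (h, \<alpha> (x, \<Phi> x s) * h) + q (x, \<Phi> x s) * snd (h, \<alpha> (x, \<Phi> x s) * h)))
      (at x within {0..1})"
    by (intro has_derivative_in_compose2[OF assms]) (use \<Phi>_ge s x in auto)
  then show "((\<lambda>x. w (x, \<Phi> x s)) has_real_derivative
      p (x, \<Phi> x s) + \<alpha> (x, \<Phi> x s) * q (x, \<Phi> x s)) (at x within {0..1})"
    unfolding has_field_derivative_def
    by (rule has_derivative_eq_rhs) (simp add: fun_eq_iff algebra_simps)
qed

lemma has_t_deriv_compose_\<Phi>:
  assumes "has_t_deriv T f f'"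
  shows "has_t_deriv (T + M) (\<lambda>(x, s). f (x, \<Phi> x s)) (\<lambda>(x, s). f' (x, \<Phi> x s) * \<Phi>' x s)"
  by (rule has_t_deriv_reparametrize[OF assms])
     (auto intro!: \<Phi>_ge \<Phi>_deriv_label continuous_on_subset[OF \<Phi>_continuous]
       continuous_on_subset[OF \<Phi>'_continuous] simp: slab_def)

lemma has_t_deriv_compose_\<Lambda>:
  assumes "has_t_deriv T f f'"
  shows "has_t_deriv (T + M) (\<lambda>(x, t). f (x, \<Lambda> x t)) (\<lambda>(x, t). f' (x, \<Lambda> x t) * inverse (\<Phi>' x (\<Lambda> x t)))"
proof (rule has_t_deriv_reparametrize[OF assms])
  have "continuous_on ({0..1} \<times> UNIV) (\<lambda>z. inverse ((\<lambda>(x, s). \<Phi>' x s) (fst z, (\<lambda>(x, t). \<Lambda> x t) z)))"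
    by (intro continuous_on_inverse continuous_on_compose2[OF \<Phi>'_continuous]
         continuous_intros \<Lambda>_continuous) (auto simp: less_imp_neq[OF \<Phi>'_pos, symmetric])
  then have "continuous_on ({0..1} \<times> UNIV) (\<lambda>(x, t). inverse (\<Phi>' x (\<Lambda> x t)))"
    by (simp add: split_beta)
  then show "continuous_on (slab (T + M)) (\<lambda>(x, t). inverse (\<Phi>' x (\<Lambda> x t)))"
    using continuous_on_subset slab_subset_band by blast
  show "continuous_on (slab (T + M)) (\<lambda>(x, t). \<Lambda> x t)"
    using continuous_on_subset slab_subset_band \<Lambda>_continuous by blast
qed (auto intro!: \<Lambda>_ge \<Lambda>_deriv)

lemma continuous_on_compose_\<Phi>:
  assumes "continuous_on (slab T) g"
  shows "continuous_on (slab (T + M)) (\<lambda>z. g (fst z, \<Phi> (fst z) (snd z)))"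
proof (rule continuous_on_compose2[OF assms])
  show "continuous_on (slab (T + M)) (\<lambda>z. (fst z, \<Phi> (fst z) (snd z)))"
    using continuous_on_subset[OF \<Phi>_continuous slab_subset_band]
    by (auto intro!: continuous_intros simp: split_beta)
qed (use \<Phi>_ge in \<open>auto simp: slab_def\<close>)

text \<open>
  Differentiability in \<open>t\<close> and along characteristics combine to joint differentiability. A point
  \<open>(x', t')\<close> is reached from \<open>(x, t)\<close> by following the characteristic through \<open>(x, t)\<close> up to \<open>x'\<close> and
  then moving in \<open>t\<close>. The second increment is a continuous factor times \<open>t' - \<Phi> x' s\<close>, which vanishes
  at the base point.
\<close>
lemma has_derivative_of_along:
  assumes f: "has_t_deriv T f f'" and g: "along T f g" and z: "z \<in> slab (T + 2 * M)"
  shows "(f has_derivative (\<lambda>v. (g z - \<alpha> z * f' z) * fst v + f' z * snd v)) (at z within slab T)"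
proof -
  obtain x t where xt: "z = (x, t)" "x \<in> {0..1}" "T + 2 * M \<le> t" using z by (cases z) auto
  define s where "s = \<Lambda> x t"
  have s: "T + M \<le> s" using \<Lambda>_near[OF xt(2), of t] xt(3) by (simp add: s_def)
  have \<Phi>s: "\<Phi> x s = t" using xt by (simp add: s_def)
  define D where "D = (\<lambda>q. integral {0..1} (\<lambda>\<theta>. f' (fst q, \<Phi> (fst q) s + \<theta> * (snd q - \<Phi> (fst q) s))))"
  have \<Phi>c: "continuous_on (slab T \<times> cbox (0::real) 1) (\<lambda>q. \<Phi> (fst (fst q)) s)"
    by (rule continuous_on_compose2[OF \<Phi>_continuous_fst]) (auto intro!: continuous_intros simp: slab_def)
  have seg: "T \<le> \<Phi> y s + \<theta> * (\<tau> - \<Phi> y s)" if "y \<in> {0..1}" "T \<le> \<tau>" "\<theta> \<in> {0..1}" for y \<tau> \<theta>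
    using convexD[of "{T..}" "\<Phi> y s" \<tau> "1 - \<theta>" \<theta>] \<Phi>_ge[OF that(1) s] that by (auto simp: algebra_simps)
  have "continuous_on (slab T \<times> cbox (0::real) 1)
      (\<lambda>q. f' (fst (fst q), \<Phi> (fst (fst q)) s + snd q * (snd (fst q) - \<Phi> (fst (fst q)) s)))"
  proof (rule continuous_on_compose2[OF has_t_derivD(2)[OF f]])
    show "continuous_on (slab T \<times> cbox (0::real) 1)
        (\<lambda>q. (fst (fst q), \<Phi> (fst (fst q)) s + snd q * (snd (fst q) - \<Phi> (fst (fst q)) s)))"
      by (intro continuous_intros \<Phi>c)
  qed (use seg in \<open>auto simp: slab_def\<close>)
  then have "continuous_on (slab T \<times> cbox (0::real) 1)
      (\<lambda>(q, \<theta>). f' (fst q, \<Phi> (fst q) s + \<theta> * (snd q - \<Phi> (fst q) s)))"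
    by (simp add: split_beta)
  from integral_continuous_on_param[OF this] have Dc: "continuous_on (slab T) D"
    by (simp add: D_def)
  have zT: "z \<in> slab T" using z slab_mono[of T "T + 2 * M"] M_nonneg by auto
  have D: "(D \<longlongrightarrow> D z) (at z within slab T)" using Dc zT by (simp add: continuous_on_def)
  have Dz: "D z = f' z" using xt \<Phi>s by (simp add: D_def)
  have through_fst: "((\<lambda>q. k (fst q)) has_derivative (\<lambda>v. k' * fst v)) (at z within slab T)"
    if "(k has_real_derivative k') (at x within {0..1})" for k k'
  proof (rule has_derivative_in_compose[where f = fst and f' = fst and g = k and g' = "(*) k'"])
    show "(fst has_derivative fst) (at z within slab T)"
      by (rule bounded_linear_imp_has_derivative[OF bounded_linear_fst])
    show "(k has_derivative (*) k') (at (fst z) within fst ` slab T)"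
      using that by (auto simp: has_field_derivative_def slab_def xt(1))
  qed
  have \<Phi>d: "((\<lambda>q. \<Phi> (fst q) s) has_derivative (\<lambda>v. \<alpha> z * fst v)) (at z within slab T)"
    by (rule through_fst) (use \<Phi>_deriv[OF xt(2), of s] \<Phi>s xt(1) in simp)
  have fd: "((\<lambda>q. f (fst q, \<Phi> (fst q) s)) has_derivative (\<lambda>v. g z * fst v)) (at z within slab T)"
    by (rule through_fst) (use alongD[OF g s xt(2)] \<Phi>s xt(1) in simp)
  have "((\<lambda>q. snd q - \<Phi> (fst q) s) has_derivative (\<lambda>v. snd v - \<alpha> z * fst v)) (at z within slab T)"
    by (intro derivative_intros \<Phi>d)
  from has_derivative_mult_vanishing[OF D this]
  have "((\<lambda>q. D q * (snd q - \<Phi> (fst q) s) + f (fst q, \<Phi> (fst q) s)) has_derivative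
      (\<lambda>v. D z * (snd v - \<alpha> z * fst v) + g z * fst v)) (at z within slab T)"
    using xt \<Phi>s by (intro has_derivative_add fd) simp
  moreover have "(\<lambda>v. D z * (snd v - \<alpha> z * fst v) + g z * fst v)
      = (\<lambda>v. (g z - \<alpha> z * f' z) * fst v + f' z * snd v)"
    by (simp add: Dz algebra_simps)
  ultimately have *: "((\<lambda>q. D q * (snd q - \<Phi> (fst q) s) + f (fst q, \<Phi> (fst q) s)) has_derivative
      (\<lambda>v. (g z - \<alpha> z * f' z) * fst v + f' z * snd v)) (at z within slab T)" by simp
  show ?thesis
  proof (rule has_derivative_transform[OF zT _ *])
    fix q assume q: "q \<in> slab T"
    then have "f (fst q, snd q) - f (fst q, \<Phi> (fst q) s) = D q * (snd q - \<Phi> (fst q) s)"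
      unfolding D_def using \<Phi>_ge s
      by (intro has_t_deriv_increment[OF f]) (auto simp: slab_def)
    then show "f q = D q * (snd q - \<Phi> (fst q) s) + f (fst q, \<Phi> (fst q) s)" by simp
  qed
qed

text \<open>
  The antiderivative starts on the characteristic with label \<open>T + M\<close>. In label coordinates its lower
  limit is constant and the Jacobian \<open>\<Phi>'\<close> enters the integrand, so differentiation along
  characteristics is differentiation under the integral sign. Since \<open>\<Phi>'\<close> satisfies the linearized
  equation, the result \<open>R\<close> is again a \<open>t\<close>-antiderivative of a continuous function: no \<open>t\<close>-derivative of
  \<open>w\<close> occurs.
\<close>
lemma along_t_antiderivative:
  assumes w: "continuous_on (slab T) w" and g: "continuous_on (slab T) g" and along: "along T w g"
  obtains W R where "has_t_deriv (T + 2 * M) W w" "along (T + 2 * M) W R"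
    "has_t_deriv (T + 2 * M) R (\<lambda>z. g z + w z * \<alpha>' z)"
proof -
  define S where "S = T + M"
  define wL where "wL = (\<lambda>z. w (fst z, \<Phi> (fst z) (snd z)) * \<Phi>' (fst z) (snd z))"
  define rL where "rL = (\<lambda>z. (g (fst z, \<Phi> (fst z) (snd z))
      + w (fst z, \<Phi> (fst z) (snd z)) * \<alpha>' (fst z, \<Phi> (fst z) (snd z))) * \<Phi>' (fst z) (snd z))"
  have \<Phi>'c: "continuous_on (slab S) (\<lambda>z. \<Phi>' (fst z) (snd z))"
    using continuous_on_subset[OF \<Phi>'_continuous slab_subset_band] by (simp add: split_beta)
  have wLc: "continuous_on (slab S) wL"
    unfolding wL_def S_def[symmetric]
    by (intro continuous_on_mult \<Phi>'c) (simp add: S_def continuous_on_compose_\<Phi>[OF w])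
  have rLc: "continuous_on (slab S) rL"
    unfolding rL_def
    by (intro continuous_on_mult continuous_on_add \<Phi>'c)
       (simp_all add: S_def continuous_on_compose_\<Phi> w g continuous_on_subset[OF cont' slab_subset_band])
  define WL where "WL = (\<lambda>z. integral {S..snd z} (\<lambda>\<sigma>. wL (fst z, \<sigma>)))"
  define RL where "RL = (\<lambda>z. integral {S..snd z} (\<lambda>\<sigma>. rL (fst z, \<sigma>)))"
  define W where "W = (\<lambda>(x, t). WL (x, \<Lambda> x t))"
  define R where "R = (\<lambda>(x, t). RL (x, \<Lambda> x t))"
  have S2: "S + M = T + 2 * M" by (simp add: S_def)
  have "has_t_deriv (T + 2 * M) W w"
  proof (rule has_t_deriv_cong)
    show "has_t_deriv (T + 2 * M) W (\<lambda>(x, t). wL (x, \<Lambda> x t) * inverse (\<Phi>' x (\<Lambda> x t)))"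
      unfolding W_def WL_def S2[symmetric]
      by (intro has_t_deriv_compose_\<Lambda> has_t_deriv_antiderivative wLc)
  qed (auto simp: wL_def less_imp_neq[OF \<Phi>'_pos, symmetric])
  moreover have "has_t_deriv (T + 2 * M) R (\<lambda>z. g z + w z * \<alpha>' z)"
  proof (rule has_t_deriv_cong)
    show "has_t_deriv (T + 2 * M) R (\<lambda>(x, t). rL (x, \<Lambda> x t) * inverse (\<Phi>' x (\<Lambda> x t)))"
      unfolding R_def RL_def S2[symmetric]
      by (intro has_t_deriv_compose_\<Lambda> has_t_deriv_antiderivative rLc)
  qed (auto simp: rL_def less_imp_neq[OF \<Phi>'_pos, symmetric])
  moreover have "along (T + 2 * M) W R"
    unfolding along_def
  proof (intro allI impI ballI)
    fix s x :: real assume s: "T + 2 * M + M \<le> s" and x: "x \<in> {0..1}"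
    have "((\<lambda>x. integral (cbox S s) (\<lambda>\<sigma>. wL (x, \<sigma>))) has_real_derivative
        integral (cbox S s) (\<lambda>\<sigma>. rL (x, \<sigma>))) (at x within {0..1})"
    proof (rule leibniz_rule_field_derivative)
      show "continuous_on ({0..1} \<times> cbox S s) (\<lambda>(x, \<sigma>). rL (x, \<sigma>))"
        by (rule continuous_on_subset[where s = "slab S"]) (use rLc in \<open>auto simp: slab_def\<close>)
      fix y :: real assume y: "y \<in> {0..1}"
      have "continuous_on (cbox S s) (\<lambda>\<sigma>. wL (y, \<sigma>))"
        by (rule continuous_on_compose2[OF wLc]) (use y in \<open>auto intro!: continuous_intros\<close>)
      then show "(\<lambda>\<sigma>. wL (y, \<sigma>)) integrable_on cbox S s" by (rule integrable_continuous)
      fix \<sigma> assume \<sigma>: "\<sigma> \<in> cbox S s"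
      show "((\<lambda>x. wL (x, \<sigma>)) has_real_derivative rL (y, \<sigma>)) (at y within {0..1})"
        unfolding wL_def rL_def
        using alongD[OF along, of \<sigma> y] \<Phi>'_deriv[OF y, of \<sigma>] \<sigma> y
        by (auto intro!: derivative_eq_intros simp: S_def algebra_simps)
    qed (use x in auto)
    then have "((\<lambda>x. WL (x, s)) has_real_derivative RL (x, s)) (at x within {0..1})"
      by (simp add: WL_def RL_def)
    then have "((\<lambda>x. WL (x, s)) has_real_derivative R (x, \<Phi> x s)) (at x within {0..1})"
      using x by (simp add: R_def)
    then show "((\<lambda>x. W (x, \<Phi> x s)) has_real_derivative R (x, \<Phi> x s)) (at x within {0..1})"
      by (rule has_field_derivative_transform_within[OF _ zero_less_one x]) (auto simp: W_def)
  qed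
  ultimately show ?thesis using that by blast
qed

text \<open>
  In label coordinates the equation is a linear ordinary differential equation in \<open>x\<close> with the label as
  parameter. Its explicit solution, with integrating factor \<open>exp K\<close> and data at \<open>x\<^sub>0\<close>, is built from
  \<open>h\<close>, \<open>b\<close> and the data by operations that preserve differentiability in the parameter.
\<close>
lemma t_smooth_transport:
  assumes y: "along T y (\<lambda>z. h z - b z * y z)"
    and h: "t_smooth T h" and b: "t_smooth T b"
    and x\<^sub>0: "x\<^sub>0 \<in> {0..1}" and bdry: "t_smooth T (\<lambda>z. y (x\<^sub>0, snd z))"
  shows "t_smooth (T + 2 * M) y"
proof -
  define S where "S = T + M"
  obtain h' b' \<eta>' where h': "has_t_deriv T h h'" and b': "has_t_deriv T b b'"
    and \<eta>': "has_t_deriv T (\<lambda>z. y (x\<^sub>0, snd z)) \<eta>'"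
    using h b bdry by (auto simp: t_smooth_def)
  define hL where "hL = (\<lambda>(x, s). h (x, \<Phi> x s))"
  define bL where "bL = (\<lambda>(x, s). b (x, \<Phi> x s))"
  obtain hL' bL' where hL: "has_t_deriv S hL hL'" and bL: "has_t_deriv S bL bL'"
    using has_t_deriv_compose_\<Phi>[OF h'] has_t_deriv_compose_\<Phi>[OF b'] unfolding hL_def bL_def S_def by blast
  define K where "K = (\<lambda>z. integral {0..fst z} (\<lambda>\<xi>. bL (\<xi>, snd z)))"
  define N where "N = (\<lambda>z. integral {0..fst z} (\<lambda>\<xi>. exp (K (\<xi>, snd z)) * hL (\<xi>, snd z)))"
  obtain K' where K: "has_t_deriv S K K'" using has_t_deriv_integral[OF bL] unfolding K_def by blast
  obtain E' where EH: "has_t_deriv S (\<lambda>z. exp (K z) * hL z) E'"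
    using has_t_deriv_mult[OF has_t_deriv_exp[OF K] hL] by blast
  obtain N' where N: "has_t_deriv S N N'" using has_t_deriv_integral[OF EH] unfolding N_def by auto
  obtain \<eta>L' where \<eta>L: "has_t_deriv S (\<lambda>z. y (x\<^sub>0, \<Phi> x\<^sub>0 (snd z))) \<eta>L'"
    using has_t_deriv_freeze[OF has_t_deriv_compose_\<Phi>[OF \<eta>'] x\<^sub>0] unfolding S_def by auto
  define Z where "Z = (\<lambda>z. exp (0 - K z) * (N z - N (x\<^sub>0, snd z) + exp (K (x\<^sub>0, snd z)) * y (x\<^sub>0, \<Phi> x\<^sub>0 (snd z))))"
  obtain Z' where Z: "has_t_deriv S Z Z'"
    using has_t_deriv_mult[OF has_t_deriv_exp[OF has_t_deriv_diff[OF has_t_deriv_const K]]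
        has_t_deriv_add[OF has_t_deriv_diff[OF N has_t_deriv_freeze[OF N x\<^sub>0]]
          has_t_deriv_mult[OF has_t_deriv_exp[OF has_t_deriv_freeze[OF K x\<^sub>0]] \<eta>L]]]
    unfolding Z_def by blast
  have Z_eq: "y (x, \<Phi> x s) = Z (x, s)" if x: "x \<in> {0..1}" and s: "S \<le> s" for x s
  proof -
    have ch: "continuous_on {0..1} (\<lambda>\<xi>. f (\<xi>, s))" if "continuous_on (slab S) f" for f :: "real \<times> real \<Rightarrow> real"
      by (rule continuous_on_compose2[OF that]) (use s in \<open>auto intro!: continuous_intros simp: slab_def\<close>)
    define e where "e = (\<lambda>x. exp (K (x, s)) * y (x, \<Phi> x s) - N (x, s))"
    have "(e has_real_derivative 0) (at x within {0..1})" if x: "x \<in> {0..1}" for x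
    proof -
      have Kd: "((\<lambda>x. K (x, s)) has_real_derivative bL (x, s)) (at x within {0..1})"
        unfolding K_def fst_conv snd_conv
        by (intro integral_has_real_derivative ch[OF has_t_derivD(1)[OF bL]] x)
      have Nd: "((\<lambda>x. N (x, s)) has_real_derivative exp (K (x, s)) * hL (x, s)) (at x within {0..1})"
        unfolding N_def fst_conv snd_conv
        by (intro integral_has_real_derivative ch[OF has_t_derivD(1)[OF EH]] x)
      have yd: "((\<lambda>x. y (x, \<Phi> x s)) has_real_derivative hL (x, s) - bL (x, s) * y (x, \<Phi> x s)) (at x within {0..1})"
        using alongD[OF y _ x, of s] s by (simp add: S_def hL_def bL_def)
      show ?thesis unfolding e_def
        by (rule derivative_eq_intros Kd Nd yd refl)+ (simp add: algebra_simps)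
    qed
    then obtain c where "\<forall>x\<in>{0..1}. e x = c"
      using has_field_derivative_zero_constant[of "{0..1}" e] by auto
    with x x\<^sub>0 have "e x = e x\<^sub>0" by simp
    then have "exp (K (x, s)) * y (x, \<Phi> x s) = N (x, s) - N (x\<^sub>0, s) + exp (K (x\<^sub>0, s)) * y (x\<^sub>0, \<Phi> x\<^sub>0 s)"
      by (simp add: e_def)
    moreover have "exp (0 - K (x, s)) * (exp (K (x, s)) * y (x, \<Phi> x s)) = y (x, \<Phi> x s)"
      by (simp add: exp_minus)
    ultimately show ?thesis unfolding Z_def by simp
  qed
  have "has_t_deriv (T + 2 * M) y (\<lambda>(x, t). Z' (x, \<Lambda> x t) * inverse (\<Phi>' x (\<Lambda> x t)))"
  proof (rule has_t_deriv_cong)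
    show "has_t_deriv (T + 2 * M) (\<lambda>(x, t). Z (x, \<Lambda> x t))
       (\<lambda>(x, t). Z' (x, \<Lambda> x t) * inverse (\<Phi>' x (\<Lambda> x t)))"
      using has_t_deriv_compose_\<Lambda>[OF Z] by (simp add: S_def add.assoc mult_2[symmetric])
    fix z assume "z \<in> slab (T + 2 * M)"
    then obtain x t where z: "z = (x, t)" "x \<in> {0..1}" "T + 2 * M \<le> t" by (cases z) auto
    then show "(\<lambda>(x, t). Z (x, \<Lambda> x t)) z = y z"
      using Z_eq[of x "\<Lambda> x t"] \<Lambda>_ge[of x S t] by (simp add: S_def)
  qed simp
  then show ?thesis by (rule has_t_deriv_imp_t_smooth)
qed

text \<open>
  Formally the commutator of \<open>\<partial>\<^sub>t\<close> with \<open>\<partial>\<^sub>x + \<alpha> \<partial>\<^sub>t\<close> is \<open>\<alpha>' \<partial>\<^sub>t\<close>. As mixed derivatives of \<open>u\<close> are not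
  available, the integrated equation is differentiated in the label instead, which shows that
  \<open>v * \<Phi>'\<close> is an indefinite integral in \<open>x\<close>.
\<close>
lemma along_t_deriv:
  assumes u: "has_t_deriv T u v" and along: "along T u g" and g: "has_t_deriv T g g'"
  shows "along T v (\<lambda>z. g' z - \<alpha>' z * v z)"
  unfolding along_def
proof (intro allI impI ballI)
  fix s x :: real assume s: "T + M \<le> s" and x: "x \<in> {0..1}"
  define gL where "gL = (\<lambda>(x, s). g (x, \<Phi> x s))"
  define gL' where "gL' = (\<lambda>(x, s). g' (x, \<Phi> x s) * \<Phi>' x s)"
  have gL: "has_t_deriv (T + M) gL gL'"
    unfolding gL_def gL'_def by (rule has_t_deriv_compose_\<Phi>[OF g])
  have uL: "has_t_deriv (T + M) (\<lambda>(x, s). u (x, \<Phi> x s)) (\<lambda>(x, s). v (x, \<Phi> x s) * \<Phi>' x s)"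
    by (rule has_t_deriv_compose_\<Phi>[OF u])
  have gc: "continuous_on {0..1} (\<lambda>\<xi>. f (\<xi>, \<sigma>))" if "continuous_on (slab (T + M)) f" "T + M \<le> \<sigma>"
    for f :: "real \<times> real \<Rightarrow> real" and \<sigma>
    by (rule continuous_on_compose2[OF that(1)]) (use that(2) in \<open>auto intro!: continuous_intros simp: slab_def\<close>)
  have u_int: "u (y, \<Phi> y \<sigma>) = u (0, \<Phi> 0 \<sigma>) + integral {0..y} (\<lambda>\<xi>. gL (\<xi>, \<sigma>))"
    if y: "y \<in> {0..1}" and \<sigma>: "T + M \<le> \<sigma>" for y \<sigma>
  proof -
    have "((\<lambda>\<xi>. gL (\<xi>, \<sigma>)) has_integral u (y, \<Phi> y \<sigma>) - u (0, \<Phi> 0 \<sigma>)) {0..y}"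
      using y DERIV_subset[OF alongD[OF along \<sigma>], of _ "{0..y}"]
      by (intro fundamental_theorem_of_calculus)
         (auto simp: gL_def has_real_derivative_iff_has_vector_derivative[symmetric])
    from integral_unique[OF this] show ?thesis by simp
  qed
  have "has_t_deriv (T + M) (\<lambda>(x, s). u (x, \<Phi> x s))
     (\<lambda>z. v (0, \<Phi> 0 (snd z)) * \<Phi>' 0 (snd z) + integral {0..fst z} (\<lambda>\<xi>. gL' (\<xi>, snd z)))"
    by (rule has_t_deriv_cong[OF has_t_deriv_add[OF has_t_deriv_freeze[OF uL, of 0]
            has_t_deriv_integral[OF gL]]]) (auto simp: u_int)
  from has_t_deriv_unique[OF uL this]
  have v_int: "v (y, \<Phi> y s) * \<Phi>' y s = v (0, s) * \<Phi>' 0 s + integral {0..y} (\<lambda>\<xi>. gL' (\<xi>, s))"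
    if "y \<in> {0..1}" for y
    using that s by force
  have "((\<lambda>y. (v (0, s) * \<Phi>' 0 s + integral {0..y} (\<lambda>\<xi>. gL' (\<xi>, s))) / \<Phi>' y s) has_real_derivative
      (gL' (x, s) * \<Phi>' x s - (v (0, s) * \<Phi>' 0 s + integral {0..x} (\<lambda>\<xi>. gL' (\<xi>, s)))
         * (\<alpha>' (x, \<Phi> x s) * \<Phi>' x s)) / (\<Phi>' x s * \<Phi>' x s)) (at x within {0..1})"
    using DERIV_divide[OF DERIV_add[OF DERIV_const integral_has_real_derivative[OF gc[OF has_t_derivD(2)[OF gL] s] x]]
        \<Phi>'_deriv[OF x]] less_imp_neq[OF \<Phi>'_pos[of x s]]
    by simp
  also have "(gL' (x, s) * \<Phi>' x s - (v (0, s) * \<Phi>' 0 s + integral {0..x} (\<lambda>\<xi>. gL' (\<xi>, s)))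
         * (\<alpha>' (x, \<Phi> x s) * \<Phi>' x s)) / (\<Phi>' x s * \<Phi>' x s)
      = g' (x, \<Phi> x s) - \<alpha>' (x, \<Phi> x s) * v (x, \<Phi> x s)"
    using v_int[OF x, symmetric] less_imp_neq[OF \<Phi>'_pos[of x s]] by (simp add: gL'_def field_simps)
  finally show "((\<lambda>x. v (x, \<Phi> x s)) has_real_derivative
      g' (x, \<Phi> x s) - \<alpha>' (x, \<Phi> x s) * v (x, \<Phi> x s)) (at x within {0..1})"
  proof (rule has_field_derivative_transform_within[OF _ zero_less_one x])
    fix y :: real assume "y \<in> {0..1}"
    from v_int[OF this] show "(v (0, s) * \<Phi>' 0 s + integral {0..y} (\<lambda>\<xi>. gL' (\<xi>, s))) / \<Phi>' y s = v (y, \<Phi> y s)"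
      using less_imp_neq[OF \<Phi>'_pos[of y s]] by (simp add: field_simps)
  qed
qed

end

section \<open>Calculus of the classes Ck\<close>

lemma Ck_on_SucI:
  assumes "\<And>z. z \<in> S \<Longrightarrow> (f has_derivative D z) (at z within S)"
    and "\<And>z v. z \<in> S \<Longrightarrow> D z v = g z \<bullet> v"
    and "\<And>e. e \<in> Basis \<Longrightarrow> Ck_on k (\<lambda>z. g z \<bullet> e) S"
  shows "Ck_on (Suc k) f S"
proof -
  have "(f has_derivative (\<lambda>v. g z \<bullet> v)) (at z within S)" if "z \<in> S" for z
    by (rule has_derivative_eq_rhs[OF assms(1)[OF that]]) (use assms(2) that in \<open>simp add: fun_eq_iff\<close>)
  with assms(3) show ?thesis by (subst Ck_on.simps) blast
qed

lemma Ck_on_SucE: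
  assumes "Ck_on (Suc k) f S"
  obtains g where "\<And>z. z \<in> S \<Longrightarrow> (f has_derivative (\<lambda>v. g z \<bullet> v)) (at z within S)"
    "\<And>e. e \<in> Basis \<Longrightarrow> Ck_on k (\<lambda>z. g z \<bullet> e) S"
  using assms by (subst (asm) Ck_on.simps) blast

declare Ck_on.simps(2) [simp del]

lemma Ck_on_subset: "Ck_on k f S \<Longrightarrow> S' \<subseteq> S \<Longrightarrow> Ck_on k f S'"
proof (induction k arbitrary: f)
  case 0
  then show ?case by (auto intro: continuous_on_subset)
next
  case (Suc k)
  from Suc.prems(1) show ?case
  proof (rule Ck_on_SucE)
    fix g assume g: "\<And>z. z \<in> S \<Longrightarrow> (f has_derivative (\<lambda>v. g z \<bullet> v)) (at z within S)"
      "\<And>e. e \<in> Basis \<Longrightarrow> Ck_on k (\<lambda>z. g z \<bullet> e) S"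
    show ?thesis
      by (rule Ck_on_SucI[OF has_derivative_subset[OF g(1)] _ Suc.IH[OF g(2)]])
         (use Suc.prems(2) in auto)
  qed
qed

lemma Ck_on_cong:
  assumes "Ck_on k f S" "\<And>z. z \<in> S \<Longrightarrow> f z = g z"
  shows "Ck_on k g S"
proof (cases k)
  case 0
  then show ?thesis using assms continuous_on_cong[of S S f g] by simp
next
  case (Suc l)
  with assms(1) have "Ck_on (Suc l) f S" by simp
  then obtain G where G: "\<And>z. z \<in> S \<Longrightarrow> (f has_derivative (\<lambda>v. G z \<bullet> v)) (at z within S)"
    "\<And>e. e \<in> Basis \<Longrightarrow> Ck_on l (\<lambda>z. G z \<bullet> e) S" by (rule Ck_on_SucE) blast
  show ?thesis unfolding Suc
    by (rule Ck_on_SucI[OF has_derivative_transform[OF _ _ G(1)] _ G(2)]) (use assms(2) in auto)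
qed

lemma Ck_on_SucD: "Ck_on (Suc k) f S \<Longrightarrow> Ck_on k f S"
proof (induction k arbitrary: f)
  case 0
  then show ?case
    by (auto elim!: Ck_on_SucE intro: has_derivative_continuous_on)
next
  case (Suc k)
  from Suc.prems show ?case
    by (rule Ck_on_SucE) (rule Ck_on_SucI, auto intro: Suc.IH)
qed

lemma Ck_on_imp_continuous_on: "Ck_on k f S \<Longrightarrow> continuous_on S f"
  by (induction k) (auto dest: Ck_on_SucD)

lemma Ck_on_const: "Ck_on k (\<lambda>z. c) S"
proof (induction k arbitrary: c)
  case (Suc k)
  show ?case by (rule Ck_on_SucI[where D = "\<lambda>z v. 0" and g = "\<lambda>z. 0"]) (auto intro: Suc)
qed simp

lemma Ck_on_add: "Ck_on k f S \<Longrightarrow> Ck_on k g S \<Longrightarrow> Ck_on k (\<lambda>z. f z + g z) S"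
proof (induction k arbitrary: f g)
  case 0
  then show ?case by (auto intro: continuous_intros)
next
  case (Suc k)
  obtain F where F: "\<And>z. z \<in> S \<Longrightarrow> (f has_derivative (\<lambda>v. F z \<bullet> v)) (at z within S)"
    "\<And>e. e \<in> Basis \<Longrightarrow> Ck_on k (\<lambda>z. F z \<bullet> e) S" using Suc.prems(1) by (rule Ck_on_SucE) blast
  obtain G where G: "\<And>z. z \<in> S \<Longrightarrow> (g has_derivative (\<lambda>v. G z \<bullet> v)) (at z within S)"
    "\<And>e. e \<in> Basis \<Longrightarrow> Ck_on k (\<lambda>z. G z \<bullet> e) S" using Suc.prems(2) by (rule Ck_on_SucE) blast
  show ?case
    by (rule Ck_on_SucI[OF has_derivative_add[OF F(1) G(1)], where g = "\<lambda>z. F z + G z"])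
       (auto simp: inner_add_left intro!: Suc.IH F(2) G(2))
qed

lemma Ck_on_mult: "Ck_on k f S \<Longrightarrow> Ck_on k g S \<Longrightarrow> Ck_on k (\<lambda>z. f z * g z) S"
proof (induction k arbitrary: f g)
  case 0
  then show ?case by (auto intro: continuous_intros)
next
  case (Suc k)
  obtain F where F: "\<And>z. z \<in> S \<Longrightarrow> (f has_derivative (\<lambda>v. F z \<bullet> v)) (at z within S)"
    "\<And>e. e \<in> Basis \<Longrightarrow> Ck_on k (\<lambda>z. F z \<bullet> e) S" using Suc.prems(1) by (rule Ck_on_SucE) blast
  obtain G where G: "\<And>z. z \<in> S \<Longrightarrow> (g has_derivative (\<lambda>v. G z \<bullet> v)) (at z within S)"
    "\<And>e. e \<in> Basis \<Longrightarrow> Ck_on k (\<lambda>z. G z \<bullet> e) S" using Suc.prems(2) by (rule Ck_on_SucE) blast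
  show ?case
    by (rule Ck_on_SucI[OF has_derivative_mult[OF F(1) G(1)], where g = "\<lambda>z. f z *\<^sub>R G z + g z *\<^sub>R F z"])
       (auto simp: inner_add_left intro!: Ck_on_add Suc.IH F(2) G(2) Ck_on_SucD[OF Suc.prems(1)]
          Ck_on_SucD[OF Suc.prems(2)])
qed

lemma Ck_on_diff:
  assumes "Ck_on k f S" "Ck_on k g S"
  shows "Ck_on k (\<lambda>z. f z - g z) S"
  using Ck_on_add[OF assms(1) Ck_on_mult[OF Ck_on_const[of k "-1"] assms(2)]] by simp

lemma Ck_on_sum: "(\<And>i. i \<in> I \<Longrightarrow> Ck_on k (f i) S) \<Longrightarrow> Ck_on k (\<lambda>z. \<Sum>i\<in>I. f i z) S"
  by (induction I rule: infinite_finite_induct) (auto intro: Ck_on_add Ck_on_const)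

lemma Ck_on_inverse:
  assumes nz: "\<And>z. z \<in> S \<Longrightarrow> f z \<noteq> 0"
  shows "Ck_on k f S \<Longrightarrow> Ck_on k (\<lambda>z. inverse (f z)) S"
proof (induction k)
  case 0
  then show ?case using assms by (auto intro!: continuous_intros)
next
  case (Suc k)
  obtain F where F: "\<And>z. z \<in> S \<Longrightarrow> (f has_derivative (\<lambda>v. F z \<bullet> v)) (at z within S)"
    "\<And>e. e \<in> Basis \<Longrightarrow> Ck_on k (\<lambda>z. F z \<bullet> e) S" using Suc.prems by (rule Ck_on_SucE) blast
  let ?F = "\<lambda>z. (-1 * (inverse (f z) * inverse (f z))) *\<^sub>R F z"
  have inv: "Ck_on k (\<lambda>z. inverse (f z)) S" using Suc.IH[OF Ck_on_SucD[OF Suc.prems]] .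
  have "Ck_on k (\<lambda>z. ?F z \<bullet> e) S" if "e \<in> Basis" for e
    unfolding inner_scaleR_left by (intro Ck_on_mult Ck_on_const inv F(2) that)
  then show ?case
    by (intro Ck_on_SucI[OF Deriv.has_derivative_inverse[OF nz F(1)], where g = ?F]) auto
qed

text \<open>
  For the partial derivatives \<open>p\<close> and \<open>q\<close> the gradient required by \<open>Ck_on\<close> is the pair of both.
\<close>
lemma Ck_on_Suc_partials:
  fixes f :: "real \<times> real \<Rightarrow> real"
  assumes d: "\<And>z. z \<in> S \<Longrightarrow> (f has_derivative (\<lambda>v. p z * fst v + q z * snd v)) (at z within S)"
    and "Ck_on k p S" "Ck_on k q S"
  shows "Ck_on (Suc k) f S"
  by (rule Ck_on_SucI[OF d, where g = "\<lambda>z. (p z, q z)"])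
     (use assms(2,3) in \<open>auto simp: Basis_prod_def inner_prod_def\<close>)

lemma Ck_on_Suc_partialsE:
  fixes f :: "real \<times> real \<Rightarrow> real"
  assumes "Ck_on (Suc k) f S"
  obtains p q where "\<And>z. z \<in> S \<Longrightarrow> (f has_derivative (\<lambda>v. p z * fst v + q z * snd v)) (at z within S)"
    and "Ck_on k p S" "Ck_on k q S"
proof -
  obtain g where g: "\<And>z. z \<in> S \<Longrightarrow> (f has_derivative (\<lambda>v. g z \<bullet> v)) (at z within S)"
    "\<And>e. e \<in> Basis \<Longrightarrow> Ck_on k (\<lambda>z. g z \<bullet> e) S" using assms by (rule Ck_on_SucE) blast
  have "(1, 0) \<in> (Basis :: (real \<times> real) set)" "(0, 1) \<in> (Basis :: (real \<times> real) set)"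
    by (auto simp: Basis_prod_def)
  with g(2) have c: "Ck_on k (\<lambda>z. g z \<bullet> (1, 0)) S" "Ck_on k (\<lambda>z. g z \<bullet> (0, 1)) S" by blast+
  show ?thesis
  proof (rule that)
    show "(f has_derivative (\<lambda>v. fst (g z) * fst v + snd (g z) * snd v)) (at z within S)" if "z \<in> S" for z
      by (rule has_derivative_eq_rhs[OF g(1)[OF that]]) (simp add: fun_eq_iff inner_prod_def)
  qed (use c in \<open>simp_all add: inner_prod_def\<close>)
qed

lemma has_t_deriv_of_has_derivative:
  assumes d: "\<And>z. z \<in> slab T \<Longrightarrow> (f has_derivative (\<lambda>v. p z * fst v + q z * snd v)) (at z within slab T)"
    and q: "continuous_on (slab T) q"
  shows "has_t_deriv T f q"
  unfolding has_t_deriv_def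
proof (intro conjI allI impI q)
  show "continuous_on (slab T) f" using d by (rule has_derivative_continuous_on)
  fix x t assume xt: "(x, t) \<in> slab T"
  have "((\<lambda>\<tau>. f (x, \<tau>)) has_derivative (\<lambda>h. p (x, t) * fst (0, h) + q (x, t) * snd (0 :: real, h))) (at t within {T..})"
    by (intro has_derivative_in_compose2[OF d] has_derivative_Pair has_derivative_const has_derivative_ident)
       (use xt in auto)
  then show "((\<lambda>\<tau>. f (x, \<tau>)) has_real_derivative q (x, t)) (at t within {T..})"
    by (simp add: has_field_derivative_def)
qed

lemma Ck_on_Suc_has_t_derivE:
  assumes "Ck_on (Suc k) f (slab T)"
  obtains f' where "has_t_deriv T f f'" "Ck_on k f' (slab T)"
  using assms
  by (metis Ck_on_Suc_partialsE has_t_deriv_of_has_derivative Ck_on_imp_continuous_on)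

lemma has_t_deriv_of_Ck_on_time:
  assumes "Ck_on (Suc k) h {T..}"
  obtains h' where "has_t_deriv T (\<lambda>z. h (snd z)) (\<lambda>z. h' (snd z))" "Ck_on k h' {T..}"
proof -
  obtain g where g: "\<And>t. t \<in> {T..} \<Longrightarrow> (h has_derivative (\<lambda>v. g t \<bullet> v)) (at t within {T..})"
    "\<And>e. e \<in> Basis \<Longrightarrow> Ck_on k (\<lambda>t. g t \<bullet> e) {T..}" using assms by (rule Ck_on_SucE) blast
  have gk: "Ck_on k g {T..}" using g(2)[of 1] by simp
  have hd: "(h has_real_derivative g t) (at t within {T..})" if "T \<le> t" for t
    unfolding has_field_derivative_def
    by (rule has_derivative_eq_rhs[OF g(1)]) (use that in \<open>auto simp: fun_eq_iff\<close>)
  have c: "continuous_on (slab T) (\<lambda>z. f (snd z))" if "continuous_on {T..} f" for f :: "real \<Rightarrow> real"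
    by (rule continuous_on_compose2[OF that]) (auto intro!: continuous_intros simp: slab_def)
  have "has_t_deriv T (\<lambda>z. h (snd z)) (\<lambda>z. g (snd z))"
    unfolding has_t_deriv_def
    using c[OF Ck_on_imp_continuous_on[OF assms]] c[OF Ck_on_imp_continuous_on[OF gk]] hd
    by auto
  with gk that show ?thesis by blast
qed

lemma t_smooth_add: "t_smooth T f \<Longrightarrow> t_smooth T g \<Longrightarrow> t_smooth T (\<lambda>z. f z + g z)"
  unfolding t_smooth_def by (blast intro: has_t_deriv_add)

lemma t_smooth_diff: "t_smooth T f \<Longrightarrow> t_smooth T g \<Longrightarrow> t_smooth T (\<lambda>z. f z - g z)"
  unfolding t_smooth_def by (blast intro: has_t_deriv_diff)

lemma t_smooth_mult: "t_smooth T f \<Longrightarrow> t_smooth T g \<Longrightarrow> t_smooth T (\<lambda>z. f z * g z)"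
  unfolding t_smooth_def by (blast intro: has_t_deriv_mult)

lemma t_smooth_sum:
  assumes "\<And>k. k \<in> I \<Longrightarrow> t_smooth T (f k)"
  shows "t_smooth T (\<lambda>z. \<Sum>k\<in>I. f k z)"
proof -
  from assms have "\<forall>k\<in>I. \<exists>f'. has_t_deriv T (f k) f'" by (simp add: t_smooth_def)
  then obtain f' where "\<forall>k\<in>I. has_t_deriv T (f k) (f' k)" by metis
  then show ?thesis using has_t_deriv_sum[of I T f f'] has_t_deriv_imp_t_smooth by blast
qed

lemma t_smooth_mono: "t_smooth T f \<Longrightarrow> T \<le> T' \<Longrightarrow> t_smooth T' f"
  unfolding t_smooth_def by (blast intro: has_t_deriv_mono)

lemma t_smooth_freeze: "t_smooth T f \<Longrightarrow> x\<^sub>0 \<in> {0..1} \<Longrightarrow> t_smooth T (\<lambda>z. f (x\<^sub>0, snd z))"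
  unfolding t_smooth_def by (blast intro: has_t_deriv_freeze)

section \<open>Smoothing for systems in evolution form\<close>

text \<open>
  The system in evolution form, with \<open>\<alpha> j\<close> in the role of \<open>1 / a\<^sub>j\<close>. The parameters collect what is shared
  by all systems that occur in the induction: the speeds, the factors \<open>P\<close> of the off-diagonal
  coupling and the abscissas \<open>x\<^sub>0\<close> of the sides at which boundary values are prescribed. The factors are
  of class \<open>C\<^sup>1\<close> only.
\<close>
locale hyperbolic_system =
  fixes n :: nat and \<alpha> \<alpha>' :: "nat \<Rightarrow> real \<times> real \<Rightarrow> real" and M :: real
    and P :: "nat \<Rightarrow> nat \<Rightarrow> real \<times> real \<Rightarrow> real" and x\<^sub>0 :: "nat \<Rightarrow> real"
  assumes flow: "j \<in> {1..n} \<Longrightarrow> char_flow (\<alpha> j) (\<alpha>' j) M"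
    and smooth_speed: "j \<in> {1..n} \<Longrightarrow> Ck_on k (\<alpha> j) (slab 0)"
    and P: "j \<in> {1..n} \<Longrightarrow> k \<in> {1..n} \<Longrightarrow> j \<noteq> k \<Longrightarrow> Ck_on 1 (P j k) (slab 0)"
    and entry: "j \<in> {1..n} \<Longrightarrow> x\<^sub>0 j \<in> {0..1}"
    and M_nonneg: "0 \<le> M"
begin

text \<open>
  The last conjunct belongs to the notion of a solution so that it is inherited by the system for the
  \<open>t\<close>-derivatives, where \<open>B\<close> changes only on the diagonal.
\<close>
definition solution ::
  "real \<Rightarrow> (nat \<Rightarrow> nat \<Rightarrow> real \<times> real \<Rightarrow> real) \<Rightarrow> (nat \<Rightarrow> real \<times> real \<Rightarrow> real) \<Rightarrow>
   (nat \<Rightarrow> real \<times> real \<Rightarrow> real) \<Rightarrow> bool" where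
  "solution T B F u \<longleftrightarrow>
     (\<forall>j\<in>{1..n}. continuous_on (slab T) (u j) \<and>
        char_flow.along (\<alpha> j) M T (u j) (\<lambda>z. F j z - (\<Sum>l\<in>{1..n}. B j l z * u l z))) \<and>
     (\<forall>j\<in>{1..n}. \<forall>l\<in>{1..n}. j \<noteq> l \<longrightarrow> (\<forall>z\<in>slab T. B j l z = P j l z * (\<alpha> j z - \<alpha> l z)))"

lemma solution_mono: "solution T B F u \<Longrightarrow> T \<le> T' \<Longrightarrow> solution T' B F u"
  unfolding solution_def
  using slab_mono[of T T'] char_flow.along_mono[OF flow] continuous_on_subset by blast

lemma speed_continuous:
  assumes "0 \<le> T" "j \<in> {1..n}"
  shows "continuous_on (slab T) (\<alpha> j)"
  using Ck_on_imp_continuous_on[OF smooth_speed[OF assms(2)]] slab_mono[OF assms(1)] continuous_on_subset by blast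

text \<open>
  The coupling term equals a derivative along the \<open>j\<close>-th characteristics minus a term that is
  differentiable in \<open>t\<close>: the factor \<open>\<alpha>\<^sub>j - \<alpha>\<^sub>k\<close> converts the derivative of \<open>W\<close> along the \<open>k\<close>-th
  characteristics into the one along the \<open>j\<close>-th.
\<close>
lemma coupling_absorbed:
  assumes T: "0 \<le> T" and sol: "solution T B F u"
    and contB: "\<And>j l. j \<in> {1..n} \<Longrightarrow> l \<in> {1..n} \<Longrightarrow> continuous_on (slab T) (B j l)"
    and contF: "\<And>j. j \<in> {1..n} \<Longrightarrow> continuous_on (slab T) (F j)"
    and jk: "j \<in> {1..n}" "k \<in> {1..n}" "j \<noteq> k"
  shows "\<exists>W R. t_smooth (T + 4 * M) W \<and> t_smooth (T + 4 * M) R \<and>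
    char_flow.along (\<alpha> j) M (T + 4 * M) W (\<lambda>z. R z + B j k z * u k z)"
proof -
  interpret j: char_flow "\<alpha> j" "\<alpha>' j" M by (rule flow[OF jk(1)])
  interpret k: char_flow "\<alpha> k" "\<alpha>' k" M by (rule flow[OF jk(2)])
  have contu: "continuous_on (slab T) (u l)" if "l \<in> {1..n}" for l
    using sol that by (auto simp: solution_def)
  have along_u: "k.along T (u k) (\<lambda>z. F k z - (\<Sum>l\<in>{1..n}. B k l z * u l z))"
    using sol jk by (auto simp: solution_def)
  have B_eq: "B j k z = P j k z * (\<alpha> j z - \<alpha> k z)" if "z \<in> slab T" for z
    using sol jk that by (auto simp: solution_def)
  have "Ck_on (Suc 0) (P j k) (slab T)"
    using Ck_on_subset[OF P[OF jk] slab_mono[OF T]] by (simp del: Ck_on.simps)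
  then obtain p q where pq: "\<And>z. z \<in> slab T \<Longrightarrow> (P j k has_derivative (\<lambda>v. p z * fst v + q z * snd v)) (at z within slab T)"
    and cpq: "continuous_on (slab T) p" "continuous_on (slab T) q"
    by (rule Ck_on_Suc_partialsE, simp, blast)
  have contP: "continuous_on (slab T) (P j k)" using pq by (rule has_derivative_continuous_on)
  define w where "w = (\<lambda>z. P j k z * u k z)"
  define g where "g = (\<lambda>z. (p z + \<alpha> k z * q z) * u k z + P j k z * (F k z - (\<Sum>l\<in>{1..n}. B k l z * u l z)))"
  have along_w: "k.along T w g"
    unfolding w_def g_def by (rule k.along_mult[OF k.along_of_has_derivative[OF pq] along_u])
  have "continuous_on (slab T) w"
    unfolding w_def by (intro continuous_intros contP contu jk)
  moreover have "continuous_on (slab T) g"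
    unfolding g_def by (intro continuous_intros contP contu contB contF cpq speed_continuous T jk)
  ultimately obtain W R where W: "has_t_deriv (T + 2 * M) W w" and WR: "k.along (T + 2 * M) W R"
    and R: "has_t_deriv (T + 2 * M) R (\<lambda>z. g z + w z * \<alpha>' k z)"
    using k.along_t_antiderivative[OF _ _ along_w] by blast
  have sub: "slab (T + 4 * M) \<subseteq> slab (T + 2 * M)" using M_nonneg by (intro slab_mono) simp
  have "j.along (T + 4 * M) W (\<lambda>z. (R z - \<alpha> k z * w z) + \<alpha> j z * w z)"
  proof (rule j.along_of_has_derivative)
    fix z assume z: "z \<in> slab (T + 4 * M)"
    have "z \<in> slab (T + 2 * M + 2 * M)" using z by (simp add: add.assoc)
    from has_derivative_subset[OF k.has_derivative_of_along[OF W WR this] sub]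
    show "(W has_derivative (\<lambda>v. (R z - \<alpha> k z * w z) * fst v + w z * snd v)) (at z within slab (T + 4 * M))" .
  qed
  then have "j.along (T + 4 * M) W (\<lambda>z. R z + B j k z * u k z)"
  proof (rule j.along_cong)
    fix z assume "z \<in> slab (T + 4 * M)"
    then have "z \<in> slab T" using slab_mono[of T "T + 4 * M"] M_nonneg by auto
    show "R z - \<alpha> k z * w z + \<alpha> j z * w z = R z + B j k z * u k z"
      by (simp only: w_def B_eq[OF \<open>z \<in> slab T\<close>]) (simp add: algebra_simps)
  qed simp
  moreover have "t_smooth (T + 4 * M) W" "t_smooth (T + 4 * M) R"
    using t_smooth_mono[of "T + 2 * M" _ "T + 4 * M"] has_t_deriv_imp_t_smooth[OF W]
      has_t_deriv_imp_t_smooth[OF R] M_nonneg by auto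
  ultimately show ?thesis by blast
qed

text \<open>
  Adding the functions \<open>W\<close> of \<open>coupling_absorbed\<close> to \<open>u j\<close> decouples the equation up to terms that are
  differentiable in \<open>t\<close>. The loss \<open>6 * M\<close> of time is made up of \<open>4 * M\<close> for the construction of \<open>W\<close> and
  \<open>2 * M\<close> for the transport.
\<close>
lemma solution_gains_t_derivative:
  assumes T: "0 \<le> T" and sol: "solution T B F u"
    and B: "\<And>j l. j \<in> {1..n} \<Longrightarrow> l \<in> {1..n} \<Longrightarrow> t_smooth T (B j l)"
    and F: "\<And>j. j \<in> {1..n} \<Longrightarrow> t_smooth T (F j)"
    and bdry: "\<And>j. j \<in> {1..n} \<Longrightarrow> t_smooth T (\<lambda>z. u j (x\<^sub>0 j, snd z))"
    and j: "j \<in> {1..n}"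
  shows "t_smooth (T + 6 * M) (u j)"
proof -
  interpret j: char_flow "\<alpha> j" "\<alpha>' j" M by (rule flow[OF j])
  define I where "I = {1..n} - {j}"
  define S where "S = T + 4 * M"
  have TS: "T \<le> S" using M_nonneg by (simp add: S_def)
  have cont: "continuous_on (slab T) f" if "t_smooth T f" for f
    using that has_t_derivD(1) by (auto simp: t_smooth_def)
  have "\<forall>k\<in>I. \<exists>W R. t_smooth S W \<and> t_smooth S R \<and> j.along S W (\<lambda>z. R z + B j k z * u k z)"
    unfolding S_def I_def
    by (intro ballI coupling_absorbed[OF T sol]) (use B F j cont in auto)
  then obtain W R where W: "\<And>k. k \<in> I \<Longrightarrow> t_smooth S (W k)" and R: "\<And>k. k \<in> I \<Longrightarrow> t_smooth S (R k)"
    and WR: "\<And>k. k \<in> I \<Longrightarrow> j.along S (W k) (\<lambda>z. R k z + B j k z * u k z)"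
    by metis
  define y where "y = (\<lambda>z. u j z + (\<Sum>k\<in>I. W k z))"
  define H where "H = (\<lambda>z. F j z + (\<Sum>k\<in>I. R k z) + B j j z * (\<Sum>k\<in>I. W k z))"
  have "j.along T (u j) (\<lambda>z. F j z - (\<Sum>l\<in>{1..n}. B j l z * u l z))"
    using sol j by (auto simp: solution_def)
  from j.along_add[OF j.along_mono[OF this TS] j.along_sum[OF WR]]
  have "j.along S y (\<lambda>z. F j z - (\<Sum>l\<in>{1..n}. B j l z * u l z) + (\<Sum>k\<in>I. R k z + B j k z * u k z))"
    unfolding y_def by simp
  moreover have "F j z - (\<Sum>l\<in>{1..n}. B j l z * u l z) + (\<Sum>k\<in>I. R k z + B j k z * u k z)
     = H z - B j j z * y z" for z
  proof -
    have "(\<Sum>l\<in>{1..n}. B j l z * u l z) = B j j z * u j z + (\<Sum>k\<in>I. B j k z * u k z)"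
      unfolding I_def by (rule sum.remove) (use j in auto)
    then show ?thesis by (simp add: H_def y_def sum.distrib algebra_simps)
  qed
  ultimately have "j.along S y (\<lambda>z. H z - B j j z * y z)" by simp
  moreover have "t_smooth S H" unfolding H_def
    by (intro t_smooth_add t_smooth_mult t_smooth_sum W R t_smooth_mono[OF F TS] t_smooth_mono[OF B TS] j)
  moreover have "t_smooth S (B j j)" by (intro t_smooth_mono[OF B TS] j)
  moreover have "t_smooth S (\<lambda>z. y (x\<^sub>0 j, snd z))" unfolding y_def
    by (intro t_smooth_add t_smooth_sum t_smooth_mono[OF bdry TS] t_smooth_freeze[OF W] entry j)
  ultimately have "t_smooth (S + 2 * M) y"
    using j.t_smooth_transport[OF _ _ _ entry[OF j]] by blast
  then have "t_smooth (S + 2 * M) (\<lambda>z. y z - (\<Sum>k\<in>I. W k z))"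
    using M_nonneg by (intro t_smooth_diff t_smooth_sum t_smooth_mono[OF W]) auto
  then show ?thesis by (simp add: y_def S_def algebra_simps)
qed

lemma speed_t_deriv: "j \<in> {1..n} \<Longrightarrow> has_t_deriv 0 (\<alpha> j) (\<alpha>' j)"
  unfolding has_t_deriv_def
proof (intro conjI allI impI)
  assume j: "j \<in> {1..n}"
  then interpret char_flow "\<alpha> j" "\<alpha>' j" M by (rule flow)
  show "continuous_on (slab 0) (\<alpha> j)" "continuous_on (slab 0) (\<alpha>' j)"
    using continuous_on_subset[OF cont slab_subset_band] continuous_on_subset[OF cont' slab_subset_band] .
  show "((\<lambda>\<tau>. \<alpha> j (x, \<tau>)) has_real_derivative \<alpha>' j (x, t)) (at t within {0..})"
    if "(x, t) \<in> slab 0" for x t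
    by (rule DERIV_subset[OF deriv]) (use that in auto)
qed

lemma smooth_speed':
  assumes "j \<in> {1..n}" "0 \<le> T"
  shows "Ck_on k (\<alpha>' j) (slab T)"
proof -
  obtain a where a: "has_t_deriv 0 (\<alpha> j) a" "Ck_on k a (slab 0)"
    using Ck_on_Suc_has_t_derivE[OF smooth_speed[OF assms(1)]] by blast
  have "Ck_on k (\<alpha>' j) (slab 0)"
    by (rule Ck_on_cong[OF a(2)]) (rule has_t_deriv_unique[OF a(1) speed_t_deriv[OF assms(1)]])
  then show ?thesis using Ck_on_subset slab_mono[OF assms(2)] by blast
qed

text \<open>
  The commutator contributes \<open>\<alpha>'\<close> to the diagonal. The terms in which \<open>B\<close> is differentiated contain the
  undifferentiated \<open>u\<close> and join the right-hand side, so the off-diagonal coupling is unchanged.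
\<close>
lemma t_derivative_solution:
  assumes sol: "solution T B F u" and T: "0 \<le> T"
    and B: "\<And>j l. j \<in> {1..n} \<Longrightarrow> l \<in> {1..n} \<Longrightarrow> has_t_deriv T (B j l) (B' j l)"
    and F: "\<And>j. j \<in> {1..n} \<Longrightarrow> has_t_deriv T (F j) (F' j)"
    and u: "\<And>j. j \<in> {1..n} \<Longrightarrow> has_t_deriv T (u j) (v j)"
  shows "solution T (\<lambda>j l z. B j l z + (if l = j then \<alpha>' j z else 0))
    (\<lambda>j z. F' j z - (\<Sum>l\<in>{1..n}. B' j l z * u l z)) v"
  unfolding solution_def
proof (intro conjI ballI impI)
  fix j assume j: "j \<in> {1..n}"
  interpret j: char_flow "\<alpha> j" "\<alpha>' j" M by (rule flow[OF j])
  show "continuous_on (slab T) (v j)" using has_t_derivD(2)[OF u[OF j]] .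
  let ?g = "\<lambda>z. F j z - (\<Sum>l\<in>{1..n}. B j l z * u l z)"
  have "has_t_deriv T ?g (\<lambda>z. F' j z - (\<Sum>l\<in>{1..n}. B' j l z * u l z + B j l z * v l z))"
    by (intro has_t_deriv_diff has_t_deriv_sum has_t_deriv_mult F B u j)
  moreover have "j.along T (u j) ?g" using sol j by (auto simp: solution_def)
  ultimately have "j.along T (v j) (\<lambda>z. F' j z - (\<Sum>l\<in>{1..n}. B' j l z * u l z + B j l z * v l z) - \<alpha>' j z * v j z)"
    using j.along_t_deriv[OF u[OF j]] by blast
  then show "j.along T (v j) (\<lambda>z. F' j z - (\<Sum>l\<in>{1..n}. B' j l z * u l z)
      - (\<Sum>l\<in>{1..n}. (B j l z + (if l = j then \<alpha>' j z else 0)) * v l z))"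
  proof (rule j.along_cong)
    fix z
    have "(\<Sum>l\<in>{1..n}. (if l = j then \<alpha>' j z else 0) * v l z) = \<alpha>' j z * v j z"
      using j by (simp add: if_distrib[of "\<lambda>c. c * _"] cong: if_cong)
    then show "F' j z - (\<Sum>l\<in>{1..n}. B' j l z * u l z + B j l z * v l z) - \<alpha>' j z * v j z
       = F' j z - (\<Sum>l\<in>{1..n}. B' j l z * u l z)
      - (\<Sum>l\<in>{1..n}. (B j l z + (if l = j then \<alpha>' j z else 0)) * v l z)"
      by (simp add: distrib_right sum.distrib)
  qed simp
qed (use sol in \<open>auto simp: solution_def\<close>)

text \<open>
  The induction hypothesis is applied twice, to \<open>u\<close> itself, which bounds the regularity of the new
  right-hand side, and then to the \<open>t\<close>-derivative \<open>v\<close>. The waiting time grows with \<open>k\<close>.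
\<close>
theorem solution_smoothing:
  assumes "0 \<le> T" "solution T B F u"
    and "\<And>j l. j \<in> {1..n} \<Longrightarrow> l \<in> {1..n} \<Longrightarrow> Ck_on k (B j l) (slab T)"
    and "\<And>j. j \<in> {1..n} \<Longrightarrow> Ck_on k (F j) (slab T)"
    and "\<And>j. j \<in> {1..n} \<Longrightarrow> Ck_on k (h j) {T..}"
    and "\<And>j t. j \<in> {1..n} \<Longrightarrow> T \<le> t \<Longrightarrow> u j (x\<^sub>0 j, t) = h j t"
  shows "\<exists>T'\<ge>T. \<forall>j\<in>{1..n}. Ck_on k (u j) (slab T')"
  using assms
proof (induction k arbitrary: T B F h u)
  case 0
  then show ?case by (intro exI[of _ T]) (auto simp: solution_def)
next
  case (Suc k)
  note T = Suc.prems(1) and sol = Suc.prems(2) and B = Suc.prems(3) and F = Suc.prems(4)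
    and h = Suc.prems(5) and bdry = Suc.prems(6)
  have split: "\<exists>f'. has_t_deriv T f f' \<and> Ck_on k f' (slab T)" if "Ck_on (Suc k) f (slab T)" for f
    using that by (rule Ck_on_Suc_has_t_derivE) blast
  have "\<forall>j\<in>{1..n}. \<forall>l\<in>{1..n}. \<exists>b. has_t_deriv T (B j l) b \<and> Ck_on k b (slab T)"
    by (intro ballI split B)
  then obtain B' where B': "\<And>j l. j \<in> {1..n} \<Longrightarrow> l \<in> {1..n} \<Longrightarrow> has_t_deriv T (B j l) (B' j l)"
    "\<And>j l. j \<in> {1..n} \<Longrightarrow> l \<in> {1..n} \<Longrightarrow> Ck_on k (B' j l) (slab T)" by metis
  have "\<forall>j\<in>{1..n}. \<exists>f. has_t_deriv T (F j) f \<and> Ck_on k f (slab T)"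
    by (intro ballI split F)
  then obtain F' where F': "\<And>j. j \<in> {1..n} \<Longrightarrow> has_t_deriv T (F j) (F' j)"
    "\<And>j. j \<in> {1..n} \<Longrightarrow> Ck_on k (F' j) (slab T)" by metis
  have "\<forall>j\<in>{1..n}. \<exists>h'. has_t_deriv T (\<lambda>z. h j (snd z)) (\<lambda>z. h' (snd z)) \<and> Ck_on k h' {T..}"
  proof
    fix j assume "j \<in> {1..n}"
    from h[OF this] show "\<exists>h'. has_t_deriv T (\<lambda>z. h j (snd z)) (\<lambda>z. h' (snd z)) \<and> Ck_on k h' {T..}"
      by (rule has_t_deriv_of_Ck_on_time) blast
  qed
  then obtain h' where h': "\<And>j. j \<in> {1..n} \<Longrightarrow> has_t_deriv T (\<lambda>z. h j (snd z)) (\<lambda>z. h' j (snd z))"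
    "\<And>j. j \<in> {1..n} \<Longrightarrow> Ck_on k (h' j) {T..}" by metis
  have bdry_deriv: "has_t_deriv T (\<lambda>z. u j (x\<^sub>0 j, snd z)) (\<lambda>z. h' j (snd z))" if "j \<in> {1..n}" for j
    by (rule has_t_deriv_cong[OF h'(1)[OF that]]) (use bdry that in \<open>auto simp: slab_def\<close>)
  have "\<forall>j\<in>{1..n}. t_smooth (T + 6 * M) (u j)"
    by (intro ballI solution_gains_t_derivative[OF T sol] has_t_deriv_imp_t_smooth[OF B'(1)]
        has_t_deriv_imp_t_smooth[OF F'(1)] has_t_deriv_imp_t_smooth[OF bdry_deriv])
  then obtain v where v: "\<And>j. j \<in> {1..n} \<Longrightarrow> has_t_deriv (T + 6 * M) (u j) (v j)"
    unfolding t_smooth_def by metis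
  have "\<exists>T'\<ge>T. \<forall>j\<in>{1..n}. Ck_on k (u j) (slab T')"
    by (rule Suc.IH[OF T sol Ck_on_SucD[OF B] Ck_on_SucD[OF F] Ck_on_SucD[OF h] bdry])
  then obtain T\<^sub>u where T\<^sub>u: "T \<le> T\<^sub>u" "\<And>j. j \<in> {1..n} \<Longrightarrow> Ck_on k (u j) (slab T\<^sub>u)"
    by blast
  define S where "S = max T\<^sub>u (T + 6 * M)"
  have S: "T\<^sub>u \<le> S" "T + 6 * M \<le> S" "T \<le> S" "0 \<le> S" using T T\<^sub>u(1) by (auto simp: S_def)
  let ?B = "\<lambda>j l z. B j l z + (if l = j then \<alpha>' j z else 0)"
  let ?F = "\<lambda>j z. F' j z - (\<Sum>l\<in>{1..n}. B' j l z * u l z)"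
  have u_S: "Ck_on k (u j) (slab S)" if "j \<in> {1..n}" for j
    using Ck_on_subset[OF T\<^sub>u(2)[OF that] slab_mono[OF S(1)]] .
  have B_S: "Ck_on k (B j l) (slab S)" "Ck_on k (B' j l) (slab S)" if "j \<in> {1..n}" "l \<in> {1..n}" for j l
    using Ck_on_subset[OF Ck_on_SucD[OF B[OF that]] slab_mono[OF S(3)]]
      Ck_on_subset[OF B'(2)[OF that] slab_mono[OF S(3)]] .
  have F_S: "Ck_on k (F j) (slab S)" "Ck_on k (F' j) (slab S)" if "j \<in> {1..n}" for j
    using Ck_on_subset[OF Ck_on_SucD[OF F[OF that]] slab_mono[OF S(3)]]
      Ck_on_subset[OF F'(2)[OF that] slab_mono[OF S(3)]] .
  have "solution S ?B ?F v"
    by (rule t_derivative_solution[OF solution_mono[OF sol S(3)] S(4)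
          has_t_deriv_mono[OF B'(1) S(3)] has_t_deriv_mono[OF F'(1) S(3)] has_t_deriv_mono[OF v S(2)]])
  moreover have "Ck_on k (?B j l) (slab S)" if "j \<in> {1..n}" "l \<in> {1..n}" for j l
    using that S(4) by (cases "l = j") (auto intro!: Ck_on_add Ck_on_const B_S smooth_speed')
  moreover have "Ck_on k (?F j) (slab S)" if "j \<in> {1..n}" for j
    by (intro Ck_on_diff Ck_on_sum Ck_on_mult F_S B_S u_S that)
  moreover have "Ck_on k (h' j) {S..}" if "j \<in> {1..n}" for j
    by (rule Ck_on_subset[OF h'(2)[OF that]]) (use S(3) in auto)
  moreover have "v j (x\<^sub>0 j, t) = h' j t" if j: "j \<in> {1..n}" and t: "S \<le> t" for j t
    using has_t_deriv_unique[OF has_t_deriv_freeze[OF has_t_deriv_mono[OF v[OF j] S(2)] entry[OF j]]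
        has_t_deriv_mono[OF bdry_deriv[OF j] S(3)], of "(0, t)"] t by simp
  ultimately have "\<exists>T'\<ge>S. \<forall>j\<in>{1..n}. Ck_on k (v j) (slab T')"
    by (rule Suc.IH[OF S(4)])
  then obtain T\<^sub>v where T\<^sub>v: "S \<le> T\<^sub>v" "\<And>j. j \<in> {1..n} \<Longrightarrow> Ck_on k (v j) (slab T\<^sub>v)"
    by blast
  define T' where "T' = T\<^sub>v + 2 * M"
  have T': "T\<^sub>v \<le> T'" "S \<le> T'" using T\<^sub>v(1) M_nonneg by (auto simp: T'_def)
  have "Ck_on (Suc k) (u j) (slab T')" if j: "j \<in> {1..n}" for j
  proof (rule Ck_on_Suc_partials)
    interpret j: char_flow "\<alpha> j" "\<alpha>' j" M by (rule flow[OF j])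
    let ?g = "\<lambda>z. F j z - (\<Sum>l\<in>{1..n}. B j l z * u l z)"
    have along_u: "j.along T\<^sub>v (u j) ?g"
      using solution_mono[OF sol, of T\<^sub>v] j T\<^sub>v(1) S(3) by (auto simp: solution_def)
    have v_Tv: "has_t_deriv T\<^sub>v (u j) (v j)"
      using has_t_deriv_mono[OF v[OF j]] S(2) T\<^sub>v(1) by auto
    show "(u j has_derivative (\<lambda>w. (?g z - \<alpha> j z * v j z) * fst w + v j z * snd w)) (at z within slab T')"
      if "z \<in> slab T'" for z
      using has_derivative_subset[OF j.has_derivative_of_along[OF v_Tv along_u] slab_mono[OF T'(1)]] that
      by (simp add: T'_def)
    have sub: "Ck_on k f (slab T')" if "Ck_on k f (slab S)" for f
      using Ck_on_subset[OF that slab_mono[OF T'(2)]] .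
    show v_T': "Ck_on k (v j) (slab T')" using Ck_on_subset[OF T\<^sub>v(2)[OF j] slab_mono[OF T'(1)]] .
    have "Ck_on k (\<alpha> j) (slab S)" using Ck_on_subset[OF smooth_speed[OF j] slab_mono[OF S(4)]] .
    then show "Ck_on k (\<lambda>z. ?g z - \<alpha> j z * v j z) (slab T')"
      by (intro Ck_on_diff Ck_on_sum Ck_on_mult v_T' sub F_S B_S u_S j)
  qed
  then show ?case using T' S(3) by (intro exI[of _ T']) auto
qed

end

section \<open>From the integrated equations to the evolution form\<close>

lemma strip_eq_slab: "strip = slab 0"
  by (simp add: strip_def slab_def)

text \<open>
  The odd reflection of \<open>t \<mapsto> \<alpha> (x, t) - \<alpha> (x, 0)\<close>, which continues a \<open>C\<^sup>1\<close> field to negative times with a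
  continuous derivative. The extension makes the flow global; only characteristics at positive times
  are used.
\<close>
definition reflect :: "(real \<times> real \<Rightarrow> real) \<Rightarrow> real \<times> real \<Rightarrow> real" where
  "reflect \<alpha> z = \<alpha> (fst z, max (snd z) 0) + (\<alpha> (fst z, 0) - \<alpha> (fst z, max (- snd z) 0))"

lemma reflect_eq [simp]: "0 \<le> t \<Longrightarrow> reflect \<alpha> (x, t) = \<alpha> (x, t)"
  by (simp add: reflect_def max_def)

lemma has_real_derivative_Un:
  fixes f :: "real \<Rightarrow> real"
  assumes "(f has_real_derivative D) (at x within S)" "(f has_real_derivative D) (at x within T)"
  shows "(f has_real_derivative D) (at x within S \<union> T)"
  using assms unfolding has_field_derivative_iff by (rule Lim_Un)

lemma char_flow_reflect:
  assumes \<alpha>: "has_t_deriv 0 \<alpha> \<alpha>'" and bound: "\<And>z. z \<in> slab 0 \<Longrightarrow> \<bar>\<alpha> z\<bar> \<le> C"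
  shows "char_flow (reflect \<alpha>) (\<lambda>z. \<alpha>' (fst z, \<bar>snd z\<bar>)) (3 * C)"
proof
  have c: "continuous_on ({0..1} \<times> UNIV) (\<lambda>z. g (fst z, k (snd z)))"
    if "continuous_on (slab 0) g" "continuous_on UNIV k" "\<And>t. 0 \<le> k t" for g :: "real \<times> real \<Rightarrow> real" and k
    by (rule continuous_on_compose2[OF that(1)])
       (use that(3) in \<open>auto simp: slab_def intro!: continuous_intros continuous_on_compose2[OF that(2)]\<close>)
  show "continuous_on ({0..1} \<times> UNIV) (reflect \<alpha>)"
    unfolding reflect_def
    by (intro continuous_intros c[OF has_t_derivD(1)[OF \<alpha>]] c[OF has_t_derivD(1)[OF \<alpha>], of "\<lambda>t. 0"]
        c[OF has_t_derivD(1)[OF \<alpha>], of "\<lambda>t. max t 0"] c[OF has_t_derivD(1)[OF \<alpha>], of "\<lambda>t. max (- t) 0"]) auto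
  show "continuous_on ({0..1} \<times> UNIV) (\<lambda>z. \<alpha>' (fst z, \<bar>snd z\<bar>))"
    by (rule c[OF has_t_derivD(2)[OF \<alpha>]]) (auto intro!: continuous_intros)
  fix x t :: real assume x: "x \<in> {0..1}"
  have "\<bar>\<alpha> (x, max t 0)\<bar> \<le> C" "\<bar>\<alpha> (x, 0)\<bar> \<le> C" "\<bar>\<alpha> (x, max (- t) 0)\<bar> \<le> C"
    using x by (auto intro!: bound)
  then show "\<bar>reflect \<alpha> (x, t)\<bar> \<le> 3 * C"
    unfolding reflect_def fst_conv snd_conv by linarith
  have right: "((\<lambda>t. reflect \<alpha> (x, t)) has_real_derivative \<alpha>' (x, \<bar>t\<bar>)) (at t within {0..})"
    if t: "0 \<le> t" for t
    using has_t_derivD(3)[OF \<alpha> x t] t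
    by (auto intro: has_field_derivative_transform_within[OF _ zero_less_one])
  have left: "((\<lambda>t. reflect \<alpha> (x, t)) has_real_derivative \<alpha>' (x, \<bar>t\<bar>)) (at t within {..0})"
    if t: "t \<le> 0" for t
  proof -
    have 1: "((\<lambda>\<tau>. \<alpha> (x, \<tau>)) has_real_derivative \<alpha>' (x, - t)) (at (- t) within uminus ` {..0})"
      using has_t_derivD(3)[OF \<alpha> x, of "- t"] t by simp
    have 2: "(uminus has_real_derivative (-1)) (at t within {..0})"
      by (auto intro!: derivative_eq_intros)
    have "((\<lambda>\<tau>. 2 * \<alpha> (x, 0) - \<alpha> (x, - \<tau>)) has_real_derivative \<alpha>' (x, \<bar>t\<bar>)) (at t within {..0})"
      using DERIV_diff[OF DERIV_const DERIV_image_chain[OF 1 2], of "2 * \<alpha> (x, 0)"] t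
      by (simp add: o_def)
    then show ?thesis
      by (rule has_field_derivative_transform_within[OF _ zero_less_one])
         (use t in \<open>auto simp: reflect_def max_def\<close>)
  qed
  have "((\<lambda>t. reflect \<alpha> (x, t)) has_real_derivative \<alpha>' (x, \<bar>t\<bar>)) (at t)"
  proof (cases "t = 0")
    case True
    have "{0..} \<union> {..0} = (UNIV :: real set)" by auto
    with has_real_derivative_Un[OF right[of 0] left[of 0]] True show ?thesis by simp
  next
    case False
    then consider (pos) "0 < t" | (neg) "t < 0" by linarith
    then show ?thesis
    proof cases
      case pos
      then have "at t within {0..} = at t" by (intro at_within_interior) simp
      with right[of t] pos show ?thesis by simp
    next
      case neg
      then have "at t within {..0} = at t" by (intro at_within_interior) simp
      with left[of t] neg show ?thesis by simp
    qed
  qed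
  then show "((\<lambda>t. reflect \<alpha> (x, t)) has_real_derivative \<alpha>' (fst (x, t), \<bar>snd (x, t)\<bar>)) (at t)"
    by simp
qed

lemma LBINT_eq_integral_difference:
  fixes g :: "real \<Rightarrow> real"
  assumes g: "continuous_on {0..1} g" and pq: "p \<in> {0..1}" "q \<in> {0..1}"
  shows "(LBINT \<eta>=ereal p..ereal q. g \<eta>) = integral {0..q} g - integral {0..p} g"
proof -
  have le: "(LBINT \<eta>=ereal p..ereal q. g \<eta>) = integral {0..q} g - integral {0..p} g"
    if "p \<le> q" "p \<in> {0..1}" "q \<in> {0..1}" for p q
  proof -
    have "set_integrable lborel {p..q} g"
      by (rule borel_integrable_atLeastAtMost') (use that in \<open>auto intro: continuous_on_subset[OF g]\<close>)
    moreover have "g integrable_on {0..q}"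
      by (rule integrable_continuous_interval) (use that in \<open>auto intro: continuous_on_subset[OF g]\<close>)
    then have "integral {0..p} g + integral {p..q} g = integral {0..q} g"
      using that by (intro Henstock_Kurzweil_Integration.integral_combine) auto
    ultimately show ?thesis using that by (simp add: interval_integral_eq_integral)
  qed
  show ?thesis
  proof (cases "p \<le> q")
    case False
    then show ?thesis using le[of q p] pq interval_integral_endpoints_reverse[of "ereal p" "ereal q" g] by simp
  qed (use le pq in auto)
qed

lemma LBINT_cong_unit:
  assumes "\<And>\<eta>. \<eta> \<in> {0..1} \<Longrightarrow> g \<eta> = (g' \<eta> :: real)" "p \<in> {0..1}" "q \<in> {0..1}"
  shows "(LBINT \<eta>=ereal p..ereal q. g \<eta>) = (LBINT \<eta>=ereal p..ereal q. g' \<eta>)"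
proof (rule interval_integral_cong)
  fix \<eta> assume "\<eta> \<in> einterval (min (ereal p) (ereal q)) (max (ereal p) (ereal q))"
  then have "min p q < \<eta>" "\<eta> < max p q"
    by (auto simp: einterval_def min_def max_def split: if_splits)
  then show "g \<eta> = g' \<eta>" using assms(2,3) by (intro assms(1)) auto
qed

text \<open>
  One speed of the original problem; \<open>e\<close> is the abscissa of the side through which its characteristics
  enter. The bound \<open>3 * C\<close> on the reflected field is also a bound for the time of passage.
\<close>
locale signed_speed =
  fixes a \<alpha>' :: "real \<times> real \<Rightarrow> real" and C :: real and e :: real
  assumes inverse_speed: "has_t_deriv 0 (\<lambda>z. 1 / a z) \<alpha>'"
    and inverse_bound: "\<And>z. z \<in> strip \<Longrightarrow> \<bar>1 / a z\<bar> \<le> C"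
    and sign: "(\<forall>z\<in>strip. 0 < a z) \<and> e = 0 \<or> (\<forall>z\<in>strip. a z < 0) \<and> e = 1"
begin

sublocale char_flow "reflect (\<lambda>z. 1 / a z)" "\<lambda>z. \<alpha>' (fst z, \<bar>snd z\<bar>)" "3 * C"
  by (rule char_flow_reflect[OF inverse_speed]) (use inverse_bound in \<open>simp add: strip_eq_slab\<close>)

lemma e_mem: "e \<in> {0..1}"
  using sign by auto

lemma characteristic_positive:
  assumes "x \<in> {0..1}" "3 * C < t" "\<eta> \<in> {0..1}"
  shows "0 < \<Phi> \<eta> (\<Lambda> x t)"
proof -
  have "\<bar>\<Phi> x (\<Lambda> x t) - \<Phi> \<eta> (\<Lambda> x t)\<bar> \<le> 3 * C * \<bar>x - \<eta>\<bar>"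
    using assms by (intro \<Phi>_lipschitz_fst)
  also have "\<dots> \<le> 3 * C * 1" using assms M_nonneg by (intro mult_left_mono) auto
  finally show ?thesis using assms by simp
qed

lemma char_arc_\<Phi>:
  assumes x: "x \<in> {0..1}" and t: "3 * C < t" and \<xi>: "\<xi> \<in> {0..1}"
  shows "char_arc a x t \<xi> (\<lambda>\<eta>. \<Phi> \<eta> (\<Lambda> x t))"
  unfolding char_arc_def
proof (intro conjI ballI)
  show "\<Phi> x (\<Lambda> x t) = t" using x by simp
  have seg: "closed_segment x \<xi> \<subseteq> {0..1}" using x \<xi> by (simp add: closed_segment_subset)
  fix \<eta> assume "\<eta> \<in> closed_segment x \<xi>"
  with seg have \<eta>: "\<eta> \<in> {0..1}" by blast
  have pos: "0 < \<Phi> \<eta> (\<Lambda> x t)" by (rule characteristic_positive[OF x t \<eta>])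
  with \<eta> show "(\<eta>, \<Phi> \<eta> (\<Lambda> x t)) \<in> strip" by (simp add: strip_def)
  show "((\<lambda>\<eta>. \<Phi> \<eta> (\<Lambda> x t)) has_real_derivative 1 / a (\<eta>, \<Phi> \<eta> (\<Lambda> x t))) (at \<eta> within closed_segment x \<xi>)"
    using DERIV_subset[OF \<Phi>_deriv[OF \<eta>] seg, of "\<Lambda> x t"] pos by simp
qed

text \<open>
  The arc stays in the strip, where the reflected field agrees with \<open>1 / a\<close>.
\<close>
lemma char_arc_unique:
  assumes w: "char_arc a x t \<xi> w" and x: "x \<in> {0..1}"
  shows "\<xi> \<in> {0..1}" "w \<xi> = \<Phi> \<xi> (\<Lambda> x t)"
proof -
  have strip: "(\<eta>, w \<eta>) \<in> strip" if "\<eta> \<in> closed_segment x \<xi>" for \<eta>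
    using w that by (simp add: char_arc_def)
  from strip[of \<xi>] show \<xi>: "\<xi> \<in> {0..1}" by (auto simp: strip_def)
  define p q where "p = min x \<xi>" and "q = max x \<xi>"
  have seg: "closed_segment x \<xi> = {p..q}"
    by (auto simp: p_def q_def closed_segment_eq_real_ivl min_def max_def)
  have sub: "{p..q} \<subseteq> {0..1}" using x \<xi> by (auto simp: p_def q_def)
  have "solves {p..q} w" unfolding solves_def
  proof
    fix \<eta> assume "\<eta> \<in> {p..q}"
    with w strip seg show "(w has_real_derivative reflect (\<lambda>z. 1 / a z) (\<eta>, w \<eta>)) (at \<eta> within {p..q})"
      by (auto simp: char_arc_def strip_def)
  qed
  moreover have "w x = \<Phi> x (\<Lambda> x t)" using w x by (simp add: char_arc_def)
  ultimately show "w \<xi> = \<Phi> \<xi> (\<Lambda> x t)"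
    using solves_unique[OF _ solves_subset[OF \<Phi>_solves sub] sub, of w x "\<Lambda> x t" \<xi>]
    by (auto simp: p_def q_def)
qed

context
  fixes x t :: real
  assumes x: "x \<in> {0..1}" and t: "3 * C < t"
begin

lemma omega_eq_\<Phi>: "\<xi> \<in> {0..1} \<Longrightarrow> omega a \<xi> x t = \<Phi> \<xi> (\<Lambda> x t)"
  unfolding omega_def using char_arc_\<Phi>[OF x t] char_arc_unique(2)[OF _ x]
  by (intro the_equality) blast+

lemma char_dom_eq: "char_dom a x t = {0..1}"
  unfolding char_dom_def using char_arc_\<Phi>[OF x t] char_arc_unique(1)[OF _ x] by blast

lemma char_boundary_eq: "char_boundary a x t = {0, 1}"
proof -
  have fr: "frontier ({0<..<1} \<times> {0<..}) = ({0..1} \<times> {0..}) - {0<..<1::real} \<times> ({0<..} :: real set)"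
    unfolding frontier_def
    by (subst interior_open) (auto simp: closure_Times open_Times)
  show ?thesis
    unfolding char_boundary_def char_dom_eq fr
    using characteristic_positive[OF x t] characteristic_positive[OF x t, of 0]
    by (auto simp: omega_eq_\<Phi> less_imp_le)
qed

lemma char_exit_eq: "char_exit a x t = e"
proof -
  define s where "s = \<Lambda> x t"
  have "\<exists>\<eta>\<in>{0<..<1}. \<Phi> 1 s - \<Phi> 0 s = reflect (\<lambda>z. 1 / a z) (\<eta>, \<Phi> \<eta> s) * (1 - 0)"
    by (rule mvt_simple) (use \<Phi>_deriv in \<open>auto simp: has_field_derivative_def\<close>)
  then obtain \<eta> where "\<eta> \<in> {0<..<1}"
    "\<Phi> 1 s - \<Phi> 0 s = reflect (\<lambda>z. 1 / a z) (\<eta>, \<Phi> \<eta> s) * (1 - 0)" by blast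
  then have \<eta>: "\<eta> \<in> {0..1}" "\<Phi> 1 s - \<Phi> 0 s = reflect (\<lambda>z. 1 / a z) (\<eta>, \<Phi> \<eta> s)" by auto
  have pos: "0 < \<Phi> \<eta> s" unfolding s_def by (rule characteristic_positive[OF x t \<eta>(1)])
  with \<eta> have diff: "\<Phi> 1 s - \<Phi> 0 s = 1 / a (\<eta>, \<Phi> \<eta> s)" and mem: "(\<eta>, \<Phi> \<eta> s) \<in> strip"
    by (auto simp: strip_def)
  have "e = 0 \<and> 0 < 1 / a (\<eta>, \<Phi> \<eta> s) \<or> e = 1 \<and> 1 / a (\<eta>, \<Phi> \<eta> s) < 0"
    using sign mem by (simp add: zero_less_divide_iff divide_less_0_iff) blast
  then have order: "e = 0 \<and> \<Phi> 0 s < \<Phi> 1 s \<or> e = 1 \<and> \<Phi> 1 s < \<Phi> 0 s"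
    unfolding diff[symmetric] by linarith
  show ?thesis
    unfolding char_exit_def char_boundary_eq
    by (rule the_equality) (use order in \<open>auto simp: omega_eq_\<Phi>[of 0] omega_eq_\<Phi>[of 1] s_def[symmetric] simp del: \<Phi>_start\<close>)
qed

end

text \<open>
  Along a single characteristic the coefficients \<open>c\<close> and \<open>d\<close> are exponentials of differences of one
  antiderivative \<open>K\<close>, so the integrated equation is a variation-of-constants formula and can be
  differentiated. Beyond the time of passage the exit point is the lateral side, hence only \<open>h\<close>
  contributes.
\<close>
lemma integrated_solution_along:
  assumes cont: "continuous_on strip b" "continuous_on strip f" "continuous_on strip S" "continuous_on strip a"
    and u: "\<And>x t. (x, t) \<in> strip \<Longrightarrow>
       u (x, t) = c_coef a b (char_exit a x t) x t
            * (if 0 < omega a (char_exit a x t) x t then h (omega a (char_exit a x t) x t) else k (char_exit a x t))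
         - (LBINT \<xi>=ereal (char_exit a x t)..ereal x. d_coef a b \<xi> x t * S (\<xi>, omega a \<xi> x t))
         + (LBINT \<xi>=ereal (char_exit a x t)..ereal x. d_coef a b \<xi> x t * f (\<xi>, omega a \<xi> x t))"
    and T: "3 * C < T"
  shows "along T u (\<lambda>z. f z / a z - (b z / a z * u z + S z / a z))"
    and "T \<le> t \<Longrightarrow> u (e, t) = h t"
proof -
  have nz: "a z \<noteq> 0" if "z \<in> strip" for z using sign that by force
  \<comment> \<open>The formula for \<open>u\<close> on the characteristic with label \<open>s\<close>; \<open>K\<close> and \<open>G\<close> depend on \<open>s\<close> alone, not on
    the point at which the integrated equation is evaluated.\<close>
  have rep: "\<exists>K G. (\<forall>y\<in>{0..1}. (K has_real_derivative b (y, \<Phi> y s) / a (y, \<Phi> y s)) (at y within {0..1})) \<and>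
      (\<forall>y\<in>{0..1}. (G has_real_derivative exp (K y) * ((f (y, \<Phi> y s) - S (y, \<Phi> y s)) / a (y, \<Phi> y s))) (at y within {0..1})) \<and>
      (\<forall>y\<in>{0..1}. 3 * C < \<Phi> y s \<longrightarrow>
         u (y, \<Phi> y s) = exp (- K y) * (exp (K e) * h (\<Phi> e s) + (G y - G e)))"
    if pos: "\<And>y. y \<in> {0..1} \<Longrightarrow> 0 < \<Phi> y s" for s
  proof -
    have c: "continuous_on {0..1} (\<lambda>y. g (y, \<Phi> y s))" if "continuous_on strip g" for g :: "real \<times> real \<Rightarrow> real"
      by (rule continuous_on_compose2[OF that])
         (use pos in \<open>auto intro!: continuous_intros \<Phi>_continuous_fst simp: strip_def less_imp_le\<close>)
    have nz': "a (y, \<Phi> y s) \<noteq> 0" if "y \<in> {0..1}" for y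
      by (rule nz) (use pos that in \<open>auto simp: strip_def less_imp_le\<close>)
    define \<beta> where "\<beta> = (\<lambda>y. b (y, \<Phi> y s) / a (y, \<Phi> y s))"
    define K where "K = (\<lambda>y. integral {0..y} \<beta>)"
    define r where "r = (\<lambda>w y. exp (K y) * (w (y, \<Phi> y s) / a (y, \<Phi> y s)))"
    have \<beta>c: "continuous_on {0..1} \<beta>" unfolding \<beta>_def using nz' by (intro continuous_intros c cont) auto
    have Kd: "(K has_real_derivative \<beta> y) (at y within {0..1})" if "y \<in> {0..1}" for y
      unfolding K_def by (rule integral_has_real_derivative[OF \<beta>c that])
    have Kc: "continuous_on {0..1} K"
      using Kd DERIV_continuous continuous_on_eq_continuous_within by blast
    have rc: "continuous_on {0..1} (r w)" if "continuous_on strip w" for w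
      unfolding r_def using nz' by (intro continuous_intros c cont that Kc) auto
    define G where "G = (\<lambda>y. integral {0..y} (r f) - integral {0..y} (r S))"
    have Gd: "(G has_real_derivative exp (K y) * ((f (y, \<Phi> y s) - S (y, \<Phi> y s)) / a (y, \<Phi> y s))) (at y within {0..1})"
      if "y \<in> {0..1}" for y
      using DERIV_diff[OF integral_has_real_derivative[OF rc[OF cont(2)] that]
          integral_has_real_derivative[OF rc[OF cont(3)] that]]
      by (simp add: G_def r_def diff_divide_distrib right_diff_distrib)
    have "u (y, \<Phi> y s) = exp (- K y) * (exp (K e) * h (\<Phi> e s) + (G y - G e))"
      if y: "y \<in> {0..1}" and big: "3 * C < \<Phi> y s" for y
    proof -
      have om: "omega a \<eta> y (\<Phi> y s) = \<Phi> \<eta> s" if "\<eta> \<in> {0..1}" for \<eta>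
        using omega_eq_\<Phi>[OF y big that] y by simp
      have ex: "char_exit a y (\<Phi> y s) = e" by (rule char_exit_eq[OF y big])
      have cc: "c_coef a b \<xi> y (\<Phi> y s) = exp (K \<xi> - K y)" if "\<xi> \<in> {0..1}" for \<xi>
      proof -
        have "(LBINT \<eta>=ereal y..ereal \<xi>. b (\<eta>, omega a \<eta> y (\<Phi> y s)) / a (\<eta>, omega a \<eta> y (\<Phi> y s)))
           = (LBINT \<eta>=ereal y..ereal \<xi>. \<beta> \<eta>)"
          by (rule LBINT_cong_unit) (use om y that in \<open>auto simp: \<beta>_def\<close>)
        then show ?thesis
          using LBINT_eq_integral_difference[OF \<beta>c y that] by (simp add: c_coef_def K_def)
      qed
      have dd: "(LBINT \<xi>=ereal e..ereal y. d_coef a b \<xi> y (\<Phi> y s) * w (\<xi>, omega a \<xi> y (\<Phi> y s)))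
          = exp (- K y) * (integral {0..y} (r w) - integral {0..e} (r w))" if w: "continuous_on strip w" for w
      proof -
        have "(LBINT \<xi>=ereal e..ereal y. d_coef a b \<xi> y (\<Phi> y s) * w (\<xi>, omega a \<xi> y (\<Phi> y s)))
          = (LBINT \<xi>=ereal e..ereal y. exp (- K y) * r w \<xi>)"
          by (rule LBINT_cong_unit)
             (use om y e_mem in \<open>auto simp: d_coef_def cc r_def exp_diff exp_minus field_simps\<close>)
        also have "\<dots> = exp (- K y) * (LBINT \<xi>=ereal e..ereal y. r w \<xi>)" by simp
        finally show ?thesis using LBINT_eq_integral_difference[OF rc[OF w] e_mem y] by simp
      qed
      have mem: "(y, \<Phi> y s) \<in> strip" using y pos[OF y] by (simp add: strip_def)
      show ?thesis
        unfolding u[OF mem] ex om[OF e_mem] cc[OF e_mem] dd[OF cont(2)] dd[OF cont(3)]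
        using pos[OF e_mem] by (simp add: G_def exp_diff exp_minus algebra_simps divide_inverse)
    qed
    then show ?thesis using Kd Gd unfolding \<beta>_def by blast
  qed
  show "along T u (\<lambda>z. f z / a z - (b z / a z * u z + S z / a z))"
    unfolding along_def
  proof (intro allI impI ballI)
    fix s x :: real assume s: "T + 3 * C \<le> s" and x: "x \<in> {0..1}"
    have big: "3 * C < \<Phi> y s" if "y \<in> {0..1}" for y using \<Phi>_ge[OF that s] T by simp
    have "0 < \<Phi> y s" if "y \<in> {0..1}" for y using big[OF that] M_nonneg by simp
    from rep[OF this] obtain K G where
      K: "(K has_real_derivative b (x, \<Phi> x s) / a (x, \<Phi> x s)) (at x within {0..1})" and
      G: "(G has_real_derivative exp (K x) * ((f (x, \<Phi> x s) - S (x, \<Phi> x s)) / a (x, \<Phi> x s))) (at x within {0..1})" and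
      eq: "\<And>y. y \<in> {0..1} \<Longrightarrow> u (y, \<Phi> y s) = exp (- K y) * (exp (K e) * h (\<Phi> e s) + (G y - G e))"
      using big x by blast
    have "((\<lambda>y. exp (- K y) * (exp (K e) * h (\<Phi> e s) + (G y - G e))) has_real_derivative
        exp (- K x) * (exp (K x) * ((f (x, \<Phi> x s) - S (x, \<Phi> x s)) / a (x, \<Phi> x s)))
        - b (x, \<Phi> x s) / a (x, \<Phi> x s) * (exp (- K x) * (exp (K e) * h (\<Phi> e s) + (G x - G e)))) (at x within {0..1})"
      by (rule derivative_eq_intros K G refl)+
        (simp add: algebra_simps add_divide_distrib diff_divide_distrib)
    also have "exp (- K x) * (exp (K x) * ((f (x, \<Phi> x s) - S (x, \<Phi> x s)) / a (x, \<Phi> x s)))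
        - b (x, \<Phi> x s) / a (x, \<Phi> x s) * (exp (- K x) * (exp (K e) * h (\<Phi> e s) + (G x - G e)))
      = f (x, \<Phi> x s) / a (x, \<Phi> x s) - (b (x, \<Phi> x s) / a (x, \<Phi> x s) * u (x, \<Phi> x s) + S (x, \<Phi> x s) / a (x, \<Phi> x s))"
      by (simp add: eq[OF x] exp_minus diff_divide_distrib)
    finally show "((\<lambda>x. u (x, \<Phi> x s)) has_real_derivative
        f (x, \<Phi> x s) / a (x, \<Phi> x s) - (b (x, \<Phi> x s) / a (x, \<Phi> x s) * u (x, \<Phi> x s) + S (x, \<Phi> x s) / a (x, \<Phi> x s)))
        (at x within {0..1})"
      by (rule has_field_derivative_transform_within[OF _ zero_less_one x]) (simp add: eq)
  qed
  show "u (e, t) = h t" if "T \<le> t"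
  proof -
    have t: "3 * C < t" using that T by simp
    from rep[of "\<Lambda> e t"] characteristic_positive[OF e_mem t] e_mem t
    obtain K :: "real \<Rightarrow> real" and G :: "real \<Rightarrow> real" where
      "u (e, \<Phi> e (\<Lambda> e t)) = exp (- K e) * (exp (K e) * h (\<Phi> e (\<Lambda> e t)) + (G e - G e))"
      by (metis \<Phi>_\<Lambda>)
    then show ?thesis using e_mem by (simp add: exp_minus)
  qed
qed

end

section \<open>The smoothing theorem\<close>

theorem theorem2p3:
  fixes n m :: nat
    and a f u :: "nat \<Rightarrow> real \<times> real \<Rightarrow> real"
    and b :: "nat \<Rightarrow> nat \<Rightarrow> real \<times> real \<Rightarrow> real"
    and h \<phi> :: "nat \<Rightarrow> real \<Rightarrow> real"
  assumes "1 \<le> n" and "m \<le> n"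
    and "\<forall>j\<in>{1..n}. Cinf_on (a j) strip"
    and "\<forall>j\<in>{1..n}. \<forall>k\<in>{1..n}. Cinf_on (b j k) strip"
    and "\<forall>j\<in>{1..n}. Cinf_on (f j) strip"
    and "\<forall>j\<in>{1..n}. Cinf_on (h j) {0..}"
    and "\<forall>j\<in>{1..n}. continuous_on {0..1} (\<phi> j)"
    and "\<forall>j\<in>{1..n}. j \<le> m \<longrightarrow> (\<forall>z\<in>strip. a j z > 0)"
    and "\<forall>j\<in>{1..n}. j > m \<longrightarrow> (\<forall>z\<in>strip. a j z < 0)"
    and "\<forall>j\<in>{1..n}. (INF z\<in>strip. \<bar>a j z\<bar>) > 0"
    and "\<forall>j\<in>{1..n}. \<forall>k\<in>{1..n}. j \<noteq> k \<longrightarrow>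
           (\<exists>p. Ck_on 1 p ({0..1} \<times> UNIV) \<and>
                (\<forall>z\<in>strip. b j k z = p z * (a k z - a j z)) \<and>
                (\<forall>z\<in>interior {z\<in>strip. a j z = a k z}. p z = 0))"
    and "continuous_solution n a b f h \<phi> u"
  shows "smoothing n u"
proof -
  note a = assms(3) and b = assms(4) and f = assms(5) and h = assms(6)
    and pos = assms(8) and neg = assms(9) and inf_pos = assms(10)
  \<comment> \<open>One constant \<open>C\<close> has to bound all reciprocal speeds, since the time \<open>M\<close> is common to the system.\<close>
  define \<delta> where "\<delta> = (\<lambda>j. INF z\<in>strip. \<bar>a j z\<bar>)"
  define C where "C = (\<Sum>j\<in>{1..n}. 1 / \<delta> j)"
  have \<delta>: "0 < \<delta> j" if "j \<in> {1..n}" for j using inf_pos that by (simp add: \<delta>_def)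
  have a_ge: "\<delta> j \<le> \<bar>a j z\<bar>" if "z \<in> strip" for j z
    unfolding \<delta>_def by (rule cINF_lower[OF bdd_belowI2[of _ 0] that]) simp
  have nz: "a j z \<noteq> 0" if "j \<in> {1..n}" "z \<in> strip" for j z
    using \<delta>[OF that(1)] a_ge[OF that(2), of j] by auto
  have C_bound: "\<bar>1 / a j z\<bar> \<le> C" if "j \<in> {1..n}" "z \<in> strip" for j z
  proof -
    have "\<bar>1 / a j z\<bar> \<le> 1 / \<delta> j"
      using \<delta>[OF that(1)] a_ge[OF that(2), of j] by (simp add: abs_divide frac_le)
    also have "\<dots> \<le> C"
      unfolding C_def by (rule member_le_sum) (use that \<delta> in \<open>auto simp: less_imp_le\<close>)
    finally show ?thesis .
  qed
  have C_nonneg: "0 \<le> C" unfolding C_def using \<delta> by (intro sum_nonneg) (simp add: less_imp_le)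
  have a_Ck: "Ck_on k (a j) (slab 0)" if "j \<in> {1..n}" for j k
    using a that by (simp add: Cinf_on_def strip_eq_slab)
  have inv_Ck: "Ck_on k (\<lambda>z. 1 / a j z) (slab 0)" if "j \<in> {1..n}" for j k
    using Ck_on_inverse[OF _ a_Ck[OF that]] nz[OF that] by (simp add: strip_eq_slab inverse_eq_divide)
  have "\<exists>\<alpha>'. has_t_deriv 0 (\<lambda>z. 1 / a j z) \<alpha>'" if "j \<in> {1..n}" for j
    by (rule Ck_on_Suc_has_t_derivE[OF inv_Ck[OF that, of "Suc 0"]]) blast
  then obtain \<alpha>' where \<alpha>': "\<And>j. j \<in> {1..n} \<Longrightarrow> has_t_deriv 0 (\<lambda>z. 1 / a j z) (\<alpha>' j)" by metis
  define e :: "nat \<Rightarrow> real" where "e = (\<lambda>j. if j \<le> m then 0 else 1)"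
  have speed: "signed_speed (a j) (\<alpha>' j) C (e j)" if "j \<in> {1..n}" for j
    by standard (use \<alpha>' C_bound pos neg that in \<open>auto simp: e_def\<close>)
  define is_factor where "is_factor = (\<lambda>j k p. Ck_on 1 p ({0..1} \<times> UNIV) \<and>
      (\<forall>z\<in>strip. b j k z = p z * (a k z - a j z)))"
  define p where "p = (\<lambda>j k. SOME p. is_factor j k p)"
  have p: "is_factor j k (p j k)" if "j \<in> {1..n}" "k \<in> {1..n}" "j \<noteq> k" for j k
    unfolding p_def
  proof (rule someI_ex[where P = "is_factor j k"])
    from bspec[OF bspec[OF assms(11) that(1)] that(2), THEN mp, OF that(3)]
    show "\<exists>p. is_factor j k p" by (elim exE conjE) (intro exI, unfold is_factor_def, intro conjI)
  qed
  define \<alpha> where "\<alpha> = (\<lambda>j. reflect (\<lambda>z. 1 / a j z))"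
  have \<alpha>_eq: "\<alpha> j z = 1 / a j z" if "z \<in> slab 0" for j z
    using that by (cases z) (simp add: \<alpha>_def)
  \<comment> \<open>Indeed \<open>p (a\<^sub>k - a\<^sub>j) / a\<^sub>j = p a\<^sub>k (1 / a\<^sub>j - 1 / a\<^sub>k)\<close>.\<close>
  define P where "P = (\<lambda>j k z. p j k z * a k z)"
  interpret hyperbolic_system n \<alpha> "\<lambda>j z. \<alpha>' j (fst z, \<bar>snd z\<bar>)" "3 * C" P e
  proof (rule hyperbolic_system.intro)
    fix j assume j: "j \<in> {1..n}"
    interpret signed_speed "a j" "\<alpha>' j" C "e j" by (rule speed[OF j])
    show "char_flow (\<alpha> j) (\<lambda>z. \<alpha>' j (fst z, \<bar>snd z\<bar>)) (3 * C)"
      unfolding \<alpha>_def by (rule char_flow_axioms)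
    show "e j \<in> {0..1}" by (rule e_mem)
    show "Ck_on k (\<alpha> j) (slab 0)" for k
      by (rule Ck_on_cong[OF inv_Ck[OF j]]) (simp add: \<alpha>_eq)
    show "Ck_on 1 (P j k) (slab 0)" if "k \<in> {1..n}" "j \<noteq> k" for k
    proof -
      have "Ck_on 1 (p j k) (slab 0)"
        using p[OF j that] Ck_on_subset[OF _ slab_subset_band] unfolding is_factor_def by blast
      then show ?thesis unfolding P_def by (intro Ck_on_mult a_Ck[OF that(1)])
    qed
  qed (use C_nonneg in simp)
  \<comment> \<open>Any time beyond the time of passage \<open>3 * C\<close> would do as a starting time.\<close>
  define T where "T = 3 * C + 1"
  have T: "0 \<le> T" "3 * C < T" "0 < T" using C_nonneg by (auto simp: T_def)
  define B where "B = (\<lambda>j l z. b j l z * (1 / a j z))"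
  define F where "F = (\<lambda>j z. f j z * (1 / a j z))"
  have cont_u: "continuous_on strip (u j)" if "j \<in> {1..n}" for j
    using assms(12) that by (auto simp: continuous_solution_def)
  have link: "char_flow.along (\<alpha> j) (3 * C) T (u j) (\<lambda>z. F j z - (\<Sum>l\<in>{1..n}. B j l z * u l z))"
      "\<And>t. T \<le> t \<Longrightarrow> u j (e j, t) = h j t"
    if j: "j \<in> {1..n}" for j
  proof -
    interpret s: signed_speed "a j" "\<alpha>' j" C "e j" by (rule speed[OF j])
    define S where "S = (\<lambda>z. \<Sum>k\<in>{1..n} - {j}. b j k z * u k z)"
    have cont: "continuous_on strip (b j l)" "continuous_on strip (f l)" "continuous_on strip (a l)"
      if "l \<in> {1..n}" for l
      using b f a j that by (auto simp: Cinf_on_def intro!: Ck_on_imp_continuous_on[of "Suc 0"])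
    have contS: "continuous_on strip S"
      unfolding S_def by (intro continuous_intros cont cont_u) auto
    have eq: "u j (x, t) = c_coef (a j) (b j j) (char_exit (a j) x t) x t
          * (if 0 < omega (a j) (char_exit (a j) x t) x t then h j (omega (a j) (char_exit (a j) x t) x t)
             else \<phi> j (char_exit (a j) x t))
        - (LBINT \<xi>=ereal (char_exit (a j) x t)..ereal x. d_coef (a j) (b j j) \<xi> x t * S (\<xi>, omega (a j) \<xi> x t))
        + (LBINT \<xi>=ereal (char_exit (a j) x t)..ereal x. d_coef (a j) (b j j) \<xi> x t * f j (\<xi>, omega (a j) \<xi> x t))"
      if "(x, t) \<in> strip" for x t
      using bspec[OF bspec[OF conjunct2[OF assms(12)[unfolded continuous_solution_def]] j] that]
      by (simp only: Let_def S_def prod.case)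
    note sol = s.integrated_solution_along[OF cont(1)[OF j] cont(2)[OF j] contS cont(3)[OF j] eq T(2)]
    show "u j (e j, t) = h j t" if "T \<le> t" for t
      using sol(2) that by blast
    have "f j z / a j z - (b j j z / a j z * u j z + S z / a j z) = F j z - (\<Sum>l\<in>{1..n}. B j l z * u l z)" for z
    proof -
      have "(\<Sum>l\<in>{1..n}. B j l z * u l z) = B j j z * u j z + (\<Sum>l\<in>{1..n} - {j}. B j l z * u l z)"
        by (rule sum.remove) (use j in auto)
      moreover have "(\<Sum>l\<in>{1..n} - {j}. B j l z * u l z) = S z / a j z"
        by (simp add: B_def S_def sum_divide_distrib)
      ultimately show ?thesis by (simp add: B_def F_def)
    qed
    with sol(1) show "char_flow.along (\<alpha> j) (3 * C) T (u j) (\<lambda>z. F j z - (\<Sum>l\<in>{1..n}. B j l z * u l z))"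
      by (simp add: \<alpha>_def)
  qed
  have sub: "slab T \<subseteq> slab 0" by (rule slab_mono[OF T(1)])
  have "solution T B F u"
    unfolding solution_def
  proof (intro conjI ballI impI)
    fix j assume j: "j \<in> {1..n}"
    show "continuous_on (slab T) (u j)"
      using continuous_on_subset[OF cont_u[OF j]] sub by (simp add: strip_eq_slab)
    show "char_flow.along (\<alpha> j) (3 * C) T (u j) (\<lambda>z. F j z - (\<Sum>l\<in>{1..n}. B j l z * u l z))"
      by (rule link(1)[OF j])
    fix l z assume l: "l \<in> {1..n}" "j \<noteq> l" and "z \<in> slab T"
    then have z: "z \<in> slab 0" "z \<in> strip" using sub by (auto simp: strip_eq_slab)
    have b_eq: "b j l z = p j l z * (a l z - a j z)" using p[OF j l] z unfolding is_factor_def by blast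
    show "B j l z = P j l z * (\<alpha> j z - \<alpha> l z)"
      unfolding B_def P_def \<alpha>_eq[OF z(1)] b_eq
      using nz[OF j z(2)] nz[OF l(1) z(2)] by (simp add: field_simps)
  qed
  moreover have "Ck_on k (B j l) (slab T)" if "j \<in> {1..n}" "l \<in> {1..n}" for j l k
    unfolding B_def using b that
    by (intro Ck_on_mult Ck_on_subset[OF inv_Ck sub] Ck_on_subset[OF _ sub, of k "b j l"])
       (auto simp: Cinf_on_def strip_eq_slab)
  moreover have "Ck_on k (F j) (slab T)" if "j \<in> {1..n}" for j k
    unfolding F_def using f that
    by (intro Ck_on_mult Ck_on_subset[OF inv_Ck sub] Ck_on_subset[OF _ sub, of k "f j"])
       (auto simp: Cinf_on_def strip_eq_slab)
  moreover have "Ck_on k (h j) {T..}" if "j \<in> {1..n}" for j k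
    by (rule Ck_on_subset[of k "h j" "{0..}"]) (use h that T(1) in \<open>auto simp: Cinf_on_def\<close>)
  moreover note link(2)
  ultimately have regular: "\<exists>T'\<ge>T. \<forall>j\<in>{1..n}. Ck_on k (u j) (slab T')" for k
    by (rule solution_smoothing[where h = h, OF T(1)])
  show ?thesis
    unfolding smoothing_def slab_def[symmetric]
  proof
    fix k
    obtain T' where "T \<le> T'" "\<forall>j\<in>{1..n}. Ck_on k (u j) (slab T')" using regular by blast
    with T(3) show "\<exists>T>0. \<forall>j\<in>{1..n}. Ck_on k (u j) (slab T)" by (intro exI[of _ T']) auto
  qed
qed

end
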